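(* Let $G$ be a smooth linear group scheme over $R$ and let $g\in G(R)$. Let $\tau:G\to G$ be an involution and let $\phi_{G,0},\phi_{G,1},\phi_{G,2}$ be lifts of Frobenius on $\widehat G$ such that $\phi_{G,1}$ and $\phi_{G,2}$ are $\mathcal H_g$-horizontal and $\mathcal B_g$-symmetric with respect to $\phi_{G,0}$. Then $\phi_{G,1}=\phi_{G,2}$.
   Context: Fix an odd prime $p$. $R$ is the unique complete discrete valuation ring with maximal ideal $pR$ and residue field an algebraic closure of $\mathbb F_p$; $\phi:R\to R$ is the unique ring homomorphism lifting Frobenius. A hat denotes $p$-adic completion. A lift of Frobenius on $\widehat G$ is a morphism of formal schemes $\widehat G\to\widehat G$ whose reduction mod $p$ is the $p$-power Frobenius and which is compatible with $\phi$ on $R$. A group scheme is linear if it is isomorphic to a closed subgroup scheme of some $GL_n$. An involution is an automorphism $\tau$ of the group scheme $G$ over $R$ with $\tau\circ\tau=\mathrm{id}$ (the identity is allowed). Put $x^{-\tau}=(x^\tau)^{-1}$, $\mathcal H_g(x)=gx^{-\tau}x$, $\mathcal B_g(x,y)=gx^{-\tau}y$. A lift $\phi_G$ is $\mathcal H_g$-horizontal with respect to $\phi_{G,0}$ if $\mathcal H_g\circ\phi_G=\phi_{G,0}\circ\mathcal H_g$; it is $\mathcal B_g$-symmetric with respect to $\phi_{G,0}$ if $\mathcal B_g\circ(\phi_{G,0}\times\phi_G)=\mathcal B_g\circ(\phi_G\times\phi_{G,0})$ as maps $\widehat G\to\widehat G$, where $f_1\times f_2:\widehat G\to\widehat G\times\widehat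 G$ has components $f_1,f_2$. *)

theory Defs
  imports "HOL-Algebra.Algebra" "HOL-Library.Poly_Mapping" "HOL-Library.Extended_Nat"
begin

section \<open>Tensor products of modules and algebras\<close>

definition alg_hom ::
    "('r, 'k) ring_scheme \<Rightarrow> ('r, 'a, 'm) module_scheme \<Rightarrow> ('r, 'b, 'n) module_scheme \<Rightarrow> ('a \<Rightarrow> 'b) set"
  where "alg_hom R A B = {f \<in> ring_hom A B.
    \<forall>r \<in> carrier R. \<forall>a \<in> carrier A. f (r \<odot>\<^bsub>A\<^esub> a) = r \<odot>\<^bsub>B\<^esub> f a}"

definition alg_via :: "('r \<Rightarrow> 'c) \<Rightarrow> ('c, 'k) ring_scheme \<Rightarrow> ('r, 'c) module"
  where "alg_via \<psi> C = \<lparr>carrier = carrier C, monoid.mult = monoid.mult C, monoid.one = monoid.one C,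
    ring.zero = ring.zero C, ring.add = ring.add C, smult = (\<lambda>r x. \<psi> r \<otimes>\<^bsub>C\<^esub> x)\<rparr>"

definition tensor_rels ::
    "('r, 'k) ring_scheme \<Rightarrow> ('r, 'a, 'm) module_scheme \<Rightarrow> ('r, 'b, 'n) module_scheme
      \<Rightarrow> (('a \<times> 'b) \<Rightarrow>\<^sub>0 int) set"
  where "tensor_rels R M N =
      {frag_of (m \<oplus>\<^bsub>M\<^esub> m', n) - frag_of (m, n) - frag_of (m', n) | m m' n.
          m \<in> carrier M \<and> m' \<in> carrier M \<and> n \<in> carrier N}
    \<union> {frag_of (m, n \<oplus>\<^bsub>N\<^esub> n') - frag_of (m, n) - frag_of (m, n') | m n n'.
          m \<in> carrier M \<and> n \<in> carrier N \<and> n' \<in> carrier N}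
    \<union> {frag_of (r \<odot>\<^bsub>M\<^esub> m, n) - frag_of (m, r \<odot>\<^bsub>N\<^esub> n) | r m n.
          r \<in> carrier R \<and> m \<in> carrier M \<and> n \<in> carrier N}"

text \<open>As an abelian group, the tensor product of \<open>M\<close> and \<open>N\<close> over \<open>R\<close> is the free abelian group on
  the pairs \<open>(m, n)\<close> modulo the following subgroup.\<close>

definition tensor_ker ::
    "('r, 'k) ring_scheme \<Rightarrow> ('r, 'a, 'm) module_scheme \<Rightarrow> ('r, 'b, 'n) module_scheme
      \<Rightarrow> (('a \<times> 'b) \<Rightarrow>\<^sub>0 int) set"
  where "tensor_ker R M N =
    generate (free_Abelian_group (carrier M \<times> carrier N)) (tensor_rels R M N)"

text \<open>The monoid ring of the multiplicative monoid of pairs. For \<open>R\<close>-algebras \<open>A\<close> and \<open>B\<close>,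
  \<open>tensor_ker R A B\<close> is an ideal of it, and the quotient is the tensor product algebra.\<close>

definition pair_ring ::
    "('a, 'm) ring_scheme \<Rightarrow> ('b, 'n) ring_scheme \<Rightarrow> (('a \<times> 'b) \<Rightarrow>\<^sub>0 int) ring"
  where "pair_ring A B = \<lparr>carrier = {c. Poly_Mapping.keys c \<subseteq> carrier A \<times> carrier B},
    monoid.mult = (\<lambda>u v. frag_extend (\<lambda>x. frag_extend
      (\<lambda>y. frag_of (fst x \<otimes>\<^bsub>A\<^esub> fst y, snd x \<otimes>\<^bsub>B\<^esub> snd y)) v) u),
    monoid.one = frag_of (\<one>\<^bsub>A\<^esub>, \<one>\<^bsub>B\<^esub>), ring.zero = 0, ring.add = (+)\<rparr>"

definition pure_tensor ::
    "('r, 'k) ring_scheme \<Rightarrow> ('r, 'a, 'm) module_scheme \<Rightarrow> ('r, 'b, 'n) module_scheme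
      \<Rightarrow> 'a \<Rightarrow> 'b \<Rightarrow> (('a \<times> 'b) \<Rightarrow>\<^sub>0 int) set"
  where "pure_tensor R A B a b = tensor_ker R A B +>\<^bsub>pair_ring A B\<^esub> frag_of (a, b)"

definition tensor ::
    "('r, 'k) ring_scheme \<Rightarrow> ('r, 'a, 'm) module_scheme \<Rightarrow> ('r, 'b, 'n) module_scheme
      \<Rightarrow> ('r, (('a \<times> 'b) \<Rightarrow>\<^sub>0 int) set) module"
  where "tensor R A B = (let Q = pair_ring A B Quot tensor_ker R A B in
    \<lparr>carrier = carrier Q, monoid.mult = monoid.mult Q, monoid.one = monoid.one Q, ring.zero = ring.zero Q, ring.add = ring.add Q,
     smult = (\<lambda>r t. pure_tensor R A B (r \<odot>\<^bsub>A\<^esub> \<one>\<^bsub>A\<^esub>) \<one>\<^bsub>B\<^esub> \<otimes>\<^bsub>Q\<^esub> t)\<rparr>)"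

definition tensor_inl ::
    "('r, 'k) ring_scheme \<Rightarrow> ('r, 'a, 'm) module_scheme \<Rightarrow> ('r, 'b, 'n) module_scheme
      \<Rightarrow> 'a \<Rightarrow> (('a \<times> 'b) \<Rightarrow>\<^sub>0 int) set"
  where "tensor_inl R A B a = pure_tensor R A B a \<one>\<^bsub>B\<^esub>"

definition tensor_inr ::
    "('r, 'k) ring_scheme \<Rightarrow> ('r, 'a, 'm) module_scheme \<Rightarrow> ('r, 'b, 'n) module_scheme
      \<Rightarrow> 'b \<Rightarrow> (('a \<times> 'b) \<Rightarrow>\<^sub>0 int) set"
  where "tensor_inr R A B b = pure_tensor R A B \<one>\<^bsub>A\<^esub> b"

text \<open>The homomorphism out of a tensor product of algebras which sends the class of \<open>(a, b)\<close> to
  \<open>f a\<close> times \<open>h b\<close>. For \<open>R\<close>-algebra homomorphisms \<open>f\<close> and \<open>h\<close> the image below is a singleton.\<close>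

definition tensor_lift ::
    "('c, 'k) ring_scheme \<Rightarrow> ('a \<Rightarrow> 'c) \<Rightarrow> ('b \<Rightarrow> 'c) \<Rightarrow> (('a \<times> 'b) \<Rightarrow>\<^sub>0 int) set \<Rightarrow> 'c"
  where "tensor_lift C f h t = the_elem
    ((\<lambda>z. \<Oplus>\<^bsub>C\<^esub>x \<in> Poly_Mapping.keys z.
        [Poly_Mapping.lookup z x] \<cdot>\<^bsub>C\<^esub> (f (fst x) \<otimes>\<^bsub>C\<^esub> h (snd x))) ` t)"


section \<open>Affine group schemes\<close>

text \<open>An affine group scheme over \<open>R\<close> is represented by its coordinate ring with the dual structure
  maps: a commutative Hopf algebra. A morphism of affine schemes is represented by the ring
  homomorphism in the opposite direction.\<close>

record ('r, 'a) hopf = "('r, 'a) module" +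
  comult :: "'a \<Rightarrow> (('a \<times> 'a) \<Rightarrow>\<^sub>0 int) set"
  counit :: "'a \<Rightarrow> 'r"
  antipode :: "'a \<Rightarrow> 'a"

text \<open>For an \<open>R\<close>-algebra \<open>C\<close>, the group of \<open>C\<close>-valued points is the set of \<open>R\<close>-algebra
  homomorphisms from the coordinate ring to \<open>C\<close>; the first map is its multiplication. The inverse
  of \<open>x\<close> is \<open>x \<circ> antipode G\<close>, and a point \<open>g\<close> over \<open>R\<close> gives the \<open>C\<close>-valued point
  \<open>const_point C g\<close>.\<close>

definition point_mult ::
    "('r, 'a, 'm) hopf_scheme \<Rightarrow> ('c, 'k) ring_scheme \<Rightarrow> ('a \<Rightarrow> 'c) \<Rightarrow> ('a \<Rightarrow> 'c) \<Rightarrow> 'a \<Rightarrow> 'c"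
  where "point_mult G C x y = tensor_lift C x y \<circ> comult G"

definition const_point :: "('r, 'c, 'm) module_scheme \<Rightarrow> ('a \<Rightarrow> 'r) \<Rightarrow> 'a \<Rightarrow> 'c"
  where "const_point C g a = g a \<odot>\<^bsub>C\<^esub> \<one>\<^bsub>C\<^esub>"

text \<open>Coassociativity is stated as associativity for the universal triple of points
  \<open>j1, j2, j3\<close>, which avoids the associator of the tensor product.\<close>

definition affine_group_scheme :: "('r, 'k) ring_scheme \<Rightarrow> ('r, 'a, 'm) hopf_scheme \<Rightarrow> bool"
  where "affine_group_scheme R G \<longleftrightarrow>
    algebra R G \<and>
    comult G \<in> alg_hom R G (tensor R G G) \<and>
    counit G \<in> alg_hom R G (alg_via id R) \<and>
    antipode G \<in> alg_hom R G G \<and>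
    (let T2 = tensor R G G; T3 = tensor R G T2;
         j1 = tensor_inl R G T2;
         j2 = tensor_inr R G T2 \<circ> tensor_inl R G G;
         j3 = tensor_inr R G T2 \<circ> tensor_inr R G G
     in \<forall>a \<in> carrier G.
       point_mult G T3 (point_mult G T3 j1 j2) j3 a = point_mult G T3 j1 (point_mult G T3 j2 j3) a) \<and>
    (\<forall>a \<in> carrier G.
       point_mult G G (const_point G (counit G)) id a = a \<and>
       point_mult G G id (const_point G (counit G)) a = a \<and>
       point_mult G G (antipode G) id a = const_point G (counit G) a \<and>
       point_mult G G id (antipode G) a = const_point G (counit G) a)"

text \<open>A morphism from an affine scheme to \<open>GL_n\<close> is an invertible \<open>n \<times> n\<close> matrix \<open>U\<close> over the
  coordinate ring, with inverse \<open>V\<close>. It is a homomorphism of group schemes iff multiplication of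
  points becomes multiplication of matrices, and it is a closed immersion iff the coordinate ring of
  \<open>GL_n\<close> surjects, i.e. the entries of \<open>U\<close> and \<open>V\<close> generate the coordinate ring of \<open>G\<close> as an
  \<open>R\<close>-algebra.\<close>

definition linear_group_scheme :: "('r, 'k) ring_scheme \<Rightarrow> ('r, 'a, 'm) hopf_scheme \<Rightarrow> bool"
  where "linear_group_scheme R G \<longleftrightarrow> (\<exists>(n::nat) U V.
    (\<forall>i<n. \<forall>j<n. U i j \<in> carrier G \<and> V i j \<in> carrier G \<and>
      (\<Oplus>\<^bsub>G\<^esub>k \<in> {..<n}. U i k \<otimes>\<^bsub>G\<^esub> V k j) = (if i = j then \<one>\<^bsub>G\<^esub> else \<zero>\<^bsub>G\<^esub>) \<and>
      (\<Oplus>\<^bsub>G\<^esub>k \<in> {..<n}. V i k \<otimes>\<^bsub>G\<^esub> U k j) = (if i = j then \<one>\<^bsub>G\<^esub> else \<zero>\<^bsub>G\<^esub>) \<and>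
      comult G (U i j) = (\<Oplus>\<^bsub>tensor R G G\<^esub>k \<in> {..<n}. pure_tensor R G G (U i k) (U k j))) \<and>
    generate_ring G ((\<lambda>r. r \<odot>\<^bsub>G\<^esub> \<one>\<^bsub>G\<^esub>) ` carrier R \<union>
      {U i j | i j. i < n \<and> j < n} \<union> {V i j | i j. i < n \<and> j < n}) = carrier G)"


section \<open>Smoothness\<close>

text \<open>\<open>A\<close> is flat if tensoring with \<open>A\<close> preserves injectivity of linear maps \<open>f : M \<rightarrow> N\<close>. The
  modules \<open>M\<close> and \<open>N\<close> are carried by subsets of the type of \<open>R\<close>; for infinite \<open>R\<close> this covers all
  finitely generated modules up to isomorphism, on which flatness can be tested.\<close>

definition flat_module :: "('r, 'k) ring_scheme \<Rightarrow> ('r, 'a, 'm) module_scheme \<Rightarrow> bool"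
  where "flat_module R A \<longleftrightarrow>
    (\<forall>(M :: ('r, 'r) module) (N :: ('r, 'r) module) f.
      module R M \<longrightarrow> module R N \<longrightarrow>
      f \<in> carrier M \<rightarrow> carrier N \<longrightarrow>
      (\<forall>x \<in> carrier M. \<forall>y \<in> carrier M. f (x \<oplus>\<^bsub>M\<^esub> y) = f x \<oplus>\<^bsub>N\<^esub> f y) \<longrightarrow>
      (\<forall>r \<in> carrier R. \<forall>x \<in> carrier M. f (r \<odot>\<^bsub>M\<^esub> x) = r \<odot>\<^bsub>N\<^esub> f x) \<longrightarrow>
      inj_on f (carrier M) \<longrightarrow>
      (\<forall>z. Poly_Mapping.keys z \<subseteq> carrier M \<times> carrier A \<longrightarrow>
        frag_extend (\<lambda>x. frag_of (f (fst x), snd x)) z \<in> tensor_ker R N A \<longrightarrow>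
        z \<in> tensor_ker R M A))"

definition ideal_height :: "('b, 'k) ring_scheme \<Rightarrow> 'b set \<Rightarrow> enat"
  where "ideal_height B q = Sup {enat n | n c.
    (\<forall>i\<le>n. primeideal (c i) B) \<and> (\<forall>i<n. c i \<subset> c (Suc i)) \<and> c n = q}"

text \<open>A noetherian ring is regular if, for every prime \<open>q\<close>, the maximal ideal of the local ring at
  \<open>q\<close> is generated by as many elements as the Krull dimension of that local ring, which is the
  height of \<open>q\<close>. Multiplying by units one may take the generators in \<open>q\<close>.\<close>

definition regular_ring :: "('b, 'k) ring_scheme \<Rightarrow> bool"
  where "regular_ring B \<longleftrightarrow> noetherian_ring B \<and>
    (\<forall>q. primeideal q B \<longrightarrow>
      (\<exists>E \<subseteq> q. finite E \<and> enat (card E) = ideal_height B q \<and>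
        (\<forall>x \<in> q. \<exists>s \<in> carrier B - q. s \<otimes>\<^bsub>B\<^esub> x \<in> Idl\<^bsub>B\<^esub> E)))"

text \<open>Smooth means of finite type (equivalently of finite presentation, over a noetherian \<open>R\<close>) and
  flat with regular geometric fibres. The geometric points \<open>\<psi>\<close> of \<open>Spec R\<close> are taken with values in
  algebraically closed fields carried by subsets of the type of \<open>R\<close>; for an infinite domain \<open>R\<close>
  there is such a point over each prime of \<open>R\<close>, and regularity of the geometric fibre does not
  depend on its choice.\<close>

definition smooth_algebra :: "('r, 'k) ring_scheme \<Rightarrow> ('r, 'a, 'm) module_scheme \<Rightarrow> bool"
  where "smooth_algebra R A \<longleftrightarrow>
    (\<exists>E \<subseteq> carrier A. finite E \<and>
      generate_ring A ((\<lambda>r. r \<odot>\<^bsub>A\<^esub> \<one>\<^bsub>A\<^esub>) ` carrier R \<union> E) = carrier A) \<and>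
    flat_module R A \<and>
    (\<forall>(L :: 'r ring) \<psi>. algebraically_closed L \<longrightarrow> \<psi> \<in> ring_hom R L \<longrightarrow>
      regular_ring (tensor R A (alg_via \<psi> L)))"


section \<open>Completion and lifts of Frobenius\<close>

definition pow_ideal :: "nat \<Rightarrow> ('a, 'm) ring_scheme \<Rightarrow> nat \<Rightarrow> 'a set"
  where "pow_ideal p A n = PIdl\<^bsub>A\<^esub> ([(p ^ n)] \<cdot>\<^bsub>A\<^esub> \<one>\<^bsub>A\<^esub>)"

text \<open>The \<open>p\<close>-adic completion is the inverse limit of the quotients modulo \<open>p ^ n\<close>. Two cosets
  correspond under a transition map iff the first is contained in the second. The formal completion
  of an affine scheme is represented by the completion of its coordinate ring; ring homomorphisms
  between completions are automatically continuous.\<close>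

definition completion :: "nat \<Rightarrow> ('a, 'm) ring_scheme \<Rightarrow> (nat \<Rightarrow> 'a set) ring"
  where "completion p A = (let Q = (\<lambda>n. A Quot pow_ideal p A n) in
    \<lparr>carrier = {s. \<forall>n. s n \<in> carrier (Q n) \<and> s (Suc n) \<subseteq> s n},
     monoid.mult = (\<lambda>s t n. s n \<otimes>\<^bsub>Q n\<^esub> t n), monoid.one = (\<lambda>n. \<one>\<^bsub>Q n\<^esub>),
     ring.zero = (\<lambda>n. \<zero>\<^bsub>Q n\<^esub>), ring.add = (\<lambda>s t n. s n \<oplus>\<^bsub>Q n\<^esub> t n)\<rparr>)"

definition to_completion :: "nat \<Rightarrow> ('a, 'm) ring_scheme \<Rightarrow> 'a \<Rightarrow> nat \<Rightarrow> 'a set"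
  where "to_completion p A a = (\<lambda>n. pow_ideal p A n +>\<^bsub>A\<^esub> a)"

definition completion_map ::
    "nat \<Rightarrow> ('b, 'm) ring_scheme \<Rightarrow> ('a \<Rightarrow> 'b) \<Rightarrow> (nat \<Rightarrow> 'a set) \<Rightarrow> nat \<Rightarrow> 'b set"
  where "completion_map p B f s = (\<lambda>n. \<Union>a \<in> s n. pow_ideal p B n +>\<^bsub>B\<^esub> f a)"

text \<open>\<open>R\<close> is a complete discrete valuation ring with maximal ideal \<open>pR\<close> whose residue field is an
  algebraic closure of its prime field.\<close>

definition base_ring :: "nat \<Rightarrow> ('r, 'k) ring_scheme \<Rightarrow> bool"
  where "base_ring p R \<longleftrightarrow>
    principal_domain R \<and>
    [p] \<cdot>\<^bsub>R\<^esub> \<one>\<^bsub>R\<^esub> \<noteq> \<zero>\<^bsub>R\<^esub> \<and>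
    (\<forall>I. maximalideal I R \<longleftrightarrow> I = PIdl\<^bsub>R\<^esub> ([p] \<cdot>\<^bsub>R\<^esub> \<one>\<^bsub>R\<^esub>)) \<and>
    bij_betw (to_completion p R) (carrier R) (carrier (completion p R)) \<and>
    (let k = R Quot (PIdl\<^bsub>R\<^esub> ([p] \<cdot>\<^bsub>R\<^esub> \<one>\<^bsub>R\<^esub>))
     in algebraic_closure k (range (\<lambda>m::int. [m] \<cdot>\<^bsub>k\<^esub> \<one>\<^bsub>k\<^esub>)))"

definition lifts_frobenius :: "nat \<Rightarrow> ('b, 'm) ring_scheme \<Rightarrow> ('b \<Rightarrow> 'b) \<Rightarrow> bool"
  where "lifts_frobenius p B F \<longleftrightarrow> F \<in> ring_hom B B \<and>
    (\<forall>b \<in> carrier B. F b \<ominus>\<^bsub>B\<^esub> b [^]\<^bsub>B\<^esub> p \<in> PIdl\<^bsub>B\<^esub> ([p] \<cdot>\<^bsub>B\<^esub> \<one>\<^bsub>B\<^esub>))"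

definition frobenius_lift ::
    "nat \<Rightarrow> ('r, 'k) ring_scheme \<Rightarrow> ('r \<Rightarrow> 'r) \<Rightarrow> ('r, 'a, 'm) hopf_scheme
      \<Rightarrow> ((nat \<Rightarrow> 'a set) \<Rightarrow> (nat \<Rightarrow> 'a set)) \<Rightarrow> bool"
  where "frobenius_lift p R \<phi> G F \<longleftrightarrow> lifts_frobenius p (completion p G) F \<and>
    (\<forall>r \<in> carrier R. F (to_completion p G (r \<odot>\<^bsub>G\<^esub> \<one>\<^bsub>G\<^esub>)) =
                     to_completion p G (\<phi> r \<odot>\<^bsub>G\<^esub> \<one>\<^bsub>G\<^esub>))"


section \<open>Involutions, horizontality and symmetry\<close>

text \<open>The second condition says that \<open>\<tau>\<close> is compatible with the group law.\<close>

definition involution ::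
    "('r, 'k) ring_scheme \<Rightarrow> ('r, 'a, 'm) hopf_scheme \<Rightarrow> ('a \<Rightarrow> 'a) \<Rightarrow> bool"
  where "involution R G \<tau> \<longleftrightarrow> \<tau> \<in> alg_hom R G G \<and>
    (\<forall>a \<in> carrier G. comult G (\<tau> a) =
      point_mult G (tensor R G G) (tensor_inl R G G \<circ> \<tau>) (tensor_inr R G G \<circ> \<tau>) a) \<and>
    (\<forall>a \<in> carrier G. \<tau> (\<tau> a) = a)"

text \<open>\<open>g x\<^sup>-\<^sup>\<tau> y\<close> for \<open>C\<close>-valued points \<open>x\<close> and \<open>y\<close>, where the exponent denotes the inverse of the
  image under \<open>\<tau>\<close>. Evaluated at the universal point and at the universal pair of points this gives
  the ring homomorphisms dual to the maps \<open>\<H>_g\<close> and \<open>\<B>_g\<close>.\<close>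

definition twisted_point ::
    "('r, 'a, 'm) hopf_scheme \<Rightarrow> ('a \<Rightarrow> 'r) \<Rightarrow> ('a \<Rightarrow> 'a) \<Rightarrow> ('r, 'c, 'n) module_scheme
      \<Rightarrow> ('a \<Rightarrow> 'c) \<Rightarrow> ('a \<Rightarrow> 'c) \<Rightarrow> 'a \<Rightarrow> 'c"
  where "twisted_point G g \<tau> C x y =
    point_mult G C (point_mult G C (const_point C g) (x \<circ> \<tau> \<circ> antipode G)) y"

definition H_map ::
    "('r, 'a, 'm) hopf_scheme \<Rightarrow> ('a \<Rightarrow> 'r) \<Rightarrow> ('a \<Rightarrow> 'a) \<Rightarrow> 'a \<Rightarrow> 'a"
  where "H_map G g \<tau> = twisted_point G g \<tau> G id id"

definition B_map ::
    "('r, 'k) ring_scheme \<Rightarrow> ('r, 'a, 'm) hopf_scheme \<Rightarrow> ('a \<Rightarrow> 'r) \<Rightarrow> ('a \<Rightarrow> 'a)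
      \<Rightarrow> 'a \<Rightarrow> (('a \<times> 'a) \<Rightarrow>\<^sub>0 int) set"
  where "B_map R G g \<tau> =
    twisted_point G g \<tau> (tensor R G G) (tensor_inl R G G) (tensor_inr R G G)"

definition H_horizontal ::
    "nat \<Rightarrow> ('r, 'a, 'm) hopf_scheme \<Rightarrow> ('a \<Rightarrow> 'r) \<Rightarrow> ('a \<Rightarrow> 'a)
      \<Rightarrow> ((nat \<Rightarrow> 'a set) \<Rightarrow> (nat \<Rightarrow> 'a set)) \<Rightarrow> ((nat \<Rightarrow> 'a set) \<Rightarrow> (nat \<Rightarrow> 'a set)) \<Rightarrow> bool"
  where "H_horizontal p G g \<tau> F F0 \<longleftrightarrow> (\<forall>s \<in> carrier (completion p G).
    F (completion_map p G (H_map G g \<tau>) s) = completion_map p G (H_map G g \<tau>) (F0 s))"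

text \<open>\<open>U\<close> is dual to the morphism from the formal completion of \<open>G\<close> to the product of two copies of
  itself with components dual to \<open>F1\<close> and \<open>F2\<close>. It exists and is unique for \<open>F1\<close> and \<open>F2\<close>
  inducing the same endomorphism of \<open>R\<close>. The completed tensor product, i.e. the completion of
  \<open>tensor R G G\<close>, represents the product.\<close>

definition is_pairing ::
    "nat \<Rightarrow> ('r, 'k) ring_scheme \<Rightarrow> ('r, 'a, 'm) hopf_scheme
      \<Rightarrow> ((nat \<Rightarrow> 'a set) \<Rightarrow> (nat \<Rightarrow> 'a set)) \<Rightarrow> ((nat \<Rightarrow> 'a set) \<Rightarrow> (nat \<Rightarrow> 'a set))
      \<Rightarrow> ((nat \<Rightarrow> (('a \<times> 'a) \<Rightarrow>\<^sub>0 int) set set) \<Rightarrow> (nat \<Rightarrow> 'a set)) \<Rightarrow> bool"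
  where "is_pairing p R G F1 F2 U \<longleftrightarrow>
    U \<in> ring_hom (completion p (tensor R G G)) (completion p G) \<and>
    (\<forall>s \<in> carrier (completion p G).
      U (completion_map p (tensor R G G) (tensor_inl R G G) s) = F1 s \<and>
      U (completion_map p (tensor R G G) (tensor_inr R G G) s) = F2 s)"

definition B_symmetric ::
    "nat \<Rightarrow> ('r, 'k) ring_scheme \<Rightarrow> ('r, 'a, 'm) hopf_scheme \<Rightarrow> ('a \<Rightarrow> 'r) \<Rightarrow> ('a \<Rightarrow> 'a)
      \<Rightarrow> ((nat \<Rightarrow> 'a set) \<Rightarrow> (nat \<Rightarrow> 'a set)) \<Rightarrow> ((nat \<Rightarrow> 'a set) \<Rightarrow> (nat \<Rightarrow> 'a set)) \<Rightarrow> bool"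
  where "B_symmetric p R G g \<tau> F F0 \<longleftrightarrow> (\<exists>U V.
    is_pairing p R G F0 F U \<and> is_pairing p R G F F0 V \<and>
    (\<forall>s \<in> carrier (completion p G).
      U (completion_map p (tensor R G G) (B_map R G g \<tau>) s) =
      V (completion_map p (tensor R G G) (B_map R G g \<tau>) s)))"

end

theory Submission
  imports Defs
begin

text \<open>
  Fix \<open>m\<close> and let \<open>D\<close> be the coordinate ring of \<open>G\<close> modulo \<open>p ^ m\<close>. Restricting a lift of Frobenius \<open>F\<close>
  to the coordinate ring and reducing modulo \<open>p ^ m\<close> gives a \<open>D\<close>-valued point \<open>x\<close> of \<open>G\<close>, where \<open>D\<close> is
  an \<open>R\<close>-algebra through \<open>\<phi>\<close>. A closed embedding into \<open>GL_n\<close> turns \<open>x\<close> and \<open>x\<^sup>-\<^sup>\<tau>\<close> into invertible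
  matrices \<open>X\<close> and \<open>Z\<close> over \<open>D\<close>, and \<open>g\<close> into a matrix \<open>P\<close>, the same one for all lifts because all
  lifts agree on the image of \<open>R\<close>. For the three given lifts, symmetry and horizontality become
  \<open>P Z\<^sub>0 X\<^sub>i = P Z\<^sub>i X\<^sub>0\<close> (\<open>i = 1, 2\<close>) and \<open>P Z\<^sub>1 X\<^sub>1 = P Z\<^sub>2 X\<^sub>2\<close>.

  Put \<open>u\<^sub>i = X\<^sub>i X\<^sub>0\<^sup>-\<^sup>1\<close>. The first relation says \<open>Z\<^sub>i = Z\<^sub>0 u\<^sub>i\<close>, and then the second one reads
  \<open>u\<^sub>1\<^sup>2 = u\<^sub>2\<^sup>2\<close> (lemma \<open>equal_of_matrix_relations\<close>). Both \<open>u\<^sub>i\<close> are congruent to the identity modulo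
  \<open>p\<close>, since all lifts induce the same map modulo \<open>p\<close>. Near the identity squaring is injective
  (lemma \<open>square_root_unique_near_one\<close>): the difference \<open>d = u\<^sub>1 - u\<^sub>2\<close> satisfies \<open>u\<^sub>1 d + d u\<^sub>2 = 0\<close>,
  so \<open>2 d\<close> is \<open>p\<close> times an element of the two-sided ideal of \<open>d\<close>; as \<open>p\<close> is odd, \<open>2\<close> is invertible
  in \<open>D\<close> and \<open>d\<close> is divisible by every power of \<open>p\<close>, hence zero because \<open>p ^ m = 0\<close> in \<open>D\<close>. Thus \<open>X\<^sub>1 = X\<^sub>2\<close>.

  A point of \<open>G\<close> is determined by its matrix (lemma \<open>point_eqI\<close>), so the two lifts agree on the
  coordinate ring modulo every \<open>p ^ m\<close>. They agree on the whole completion because a ring endomorphism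
  of it is determined by its values on the coordinate ring (lemma \<open>ring_hom_eq_of_eq_on_constants\<close>): the
  kernel of the reduction modulo \<open>p ^ m\<close> is generated by \<open>p ^ m\<close>.

  The translation into matrices (lemmas \<open>horizontal_matrix\<close> and \<open>pairing_matrix\<close>) rests on the
  universal property of the tensor product algebra, by which the product of two points is again a point
  and has the product of the two matrices as its matrix (lemma \<open>point_matrix_mult\<close>).
\<close>

section \<open>Matrices and square roots near the identity\<close>

text \<open>
  With \<open>d = u - v\<close> the hypothesis gives \<open>u d + d v = 0\<close>, that is \<open>2 d = - p (a d + d b)\<close>. Writing
  \<open>p = 1 + 2 h\<close> this becomes \<open>d = p (d + h a d + h d b)\<close>, which can be iterated: \<open>d\<close> is divisible by
  every power of \<open>p\<close>, in particular by the vanishing one.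
\<close>

lemma (in ring) square_root_unique_near_one:
  assumes p: "odd p" "[((p::nat) ^ n)] \<cdot> \<one> = \<zero>"
    and ab: "a \<in> carrier R" "b \<in> carrier R" "u = \<one> \<oplus> [p] \<cdot> a" "v = \<one> \<oplus> [p] \<cdot> b"
    and sq: "u \<otimes> u = v \<otimes> v"
  shows "u = v"
proof -
  define q where "q = [p] \<cdot> \<one>"
  define h where "h = [(p div 2)] \<cdot> \<one>"
  have qx: "q \<otimes> x = [p] \<cdot> x" "x \<otimes> q = [p] \<cdot> x" if "x \<in> carrier R" for x
    using that by (simp_all add: q_def add_pow_ldistr add_pow_rdistr)
  have q: "q \<in> carrier R" "\<And>x. x \<in> carrier R \<Longrightarrow> q \<otimes> x = x \<otimes> q"
    by (simp add: q_def, simp add: qx)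
  have "q [^] n = [(p ^ n)] \<cdot> \<one>"
  proof (induction n)
    case (Suc n)
    then show ?case using q(1) by (simp add: qx(2) add.nat_pow_pow mult.commute)
  qed simp
  then have qn: "q [^] n = \<zero>" using p(2) by simp
  have "p = 1 + (p div 2 + p div 2)" using p(1) by presburger
  then have "q = [(1 + (p div 2 + p div 2))] \<cdot> \<one>" by (simp add: q_def)
  then have h: "h \<in> carrier R" "q = \<one> \<oplus> (h \<oplus> h)"
    by (simp_all add: h_def add.nat_pow_mult[symmetric] del: One_nat_def)
  note ab = ab(1,2) ab(3)[folded qx(1)[OF ab(1)]] ab(4)[folded qx(1)[OF ab(2)]]
  define d where "d = u \<ominus> v"
  have uv: "u \<in> carrier R" "v \<in> carrier R" using q ab by auto
  have d: "d \<in> carrier R" using uv by (simp add: d_def)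
  have "u \<otimes> d \<oplus> d \<otimes> v = u \<otimes> u \<ominus> v \<otimes> v"
    unfolding d_def using uv by algebra
  also have "\<dots> = \<zero>" using uv sq by (simp add: r_right_minus_eq)
  finally have z: "u \<otimes> d \<oplus> d \<otimes> v = \<zero>" .
  have dqb: "d \<otimes> (q \<otimes> b) = q \<otimes> (d \<otimes> b)"
    using d q(1) q(2)[OF d] ab by (metis m_assoc)
  have "u \<otimes> d \<oplus> d \<otimes> v = (d \<oplus> d) \<oplus> (q \<otimes> (a \<otimes> d) \<oplus> d \<otimes> (q \<otimes> b))"
    unfolding ab(3,4) using d q(1) ab(1,2) by (simp add: l_distr r_distr m_assoc a_ac)
  with z dqb have two: "d \<oplus> d = \<ominus> (q \<otimes> (a \<otimes> d \<oplus> d \<otimes> b))"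
    using d q(1) ab(1,2) by (simp add: r_distr minus_equality)
  (* Substitute the previous equation into q d = d + h (2 d). *)
  have dstep: "d = q \<otimes> (d \<oplus> h \<otimes> (a \<otimes> d) \<oplus> h \<otimes> (d \<otimes> b))"
  proof -
    have "q \<otimes> d = d \<oplus> h \<otimes> (d \<oplus> d)"
      unfolding h(2) using d h(1) by algebra
    also have "\<dots> = d \<ominus> h \<otimes> (q \<otimes> (a \<otimes> d \<oplus> d \<otimes> b))"
      unfolding two using d h(1) q(1) ab by (simp add: r_minus minus_eq)
    also have "h \<otimes> (q \<otimes> (a \<otimes> d \<oplus> d \<otimes> b)) = q \<otimes> (h \<otimes> (a \<otimes> d \<oplus> d \<otimes> b))"
      using d h(1) q(1) q(2)[OF h(1)] ab by (metis a_closed m_assoc m_closed)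
    finally have "d = q \<otimes> d \<oplus> q \<otimes> (h \<otimes> (a \<otimes> d \<oplus> d \<otimes> b))"
      using d h(1) q(1) ab by (simp add: minus_eq a_assoc l_neg)
    also have "\<dots> = q \<otimes> (d \<oplus> h \<otimes> (a \<otimes> d) \<oplus> h \<otimes> (d \<otimes> b))"
      using d h(1) q(1) ab by algebra
    finally show ?thesis .
  qed
  have "\<exists>e \<in> carrier R. d = q [^] k \<otimes> e" for k :: nat
  proof (induction k)
    case 0
    show ?case using d by auto
  next
    case (Suc k)
    then obtain e where e: "e \<in> carrier R" "d = q [^] k \<otimes> e" by auto
    define r where "r = q [^] k"
    have r: "r \<in> carrier R" by (simp add: r_def q(1))
    have comm: "r \<otimes> x = x \<otimes> r" if x: "x \<in> carrier R" for x
      unfolding r_def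
    proof (induction k)
      case (Suc k)
      have "q [^] k \<otimes> q \<otimes> x = q [^] k \<otimes> x \<otimes> q"
        using x q by (simp add: m_assoc)
      then show ?case using Suc x q by (simp add: m_assoc)
    qed (use x in simp)
    have "d = q \<otimes> (r \<otimes> e \<oplus> h \<otimes> (a \<otimes> (r \<otimes> e)) \<oplus> h \<otimes> ((r \<otimes> e) \<otimes> b))"
      using dstep e(2) by (simp add: r_def)
    also have "h \<otimes> (a \<otimes> (r \<otimes> e)) = r \<otimes> (h \<otimes> (a \<otimes> e))"
      using comm[of "h \<otimes> a"] h(1) ab e r by (simp add: m_assoc[symmetric])
    also have "h \<otimes> ((r \<otimes> e) \<otimes> b) = r \<otimes> (h \<otimes> (e \<otimes> b))"
      using comm[of "h"] h(1) ab e r by (simp add: m_assoc[symmetric])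
    also have "q \<otimes> (r \<otimes> e \<oplus> r \<otimes> (h \<otimes> (a \<otimes> e)) \<oplus> r \<otimes> (h \<otimes> (e \<otimes> b)))
        = (q \<otimes> r) \<otimes> (e \<oplus> h \<otimes> (a \<otimes> e) \<oplus> h \<otimes> (e \<otimes> b))"
      using q(1) r e(1) h(1) ab by algebra
    also have "q \<otimes> r = q [^] Suc k" using q(2) r by (simp add: r_def)
    finally show ?case using q(1) e(1) h(1) ab by blast
  qed
  from this[of n] have "d = \<zero>" using qn by auto
  then show ?thesis using uv by (simp add: d_def)
qed

lemma (in abelian_monoid) finsum_swap:
  assumes "finite A" "finite B" "\<And>a b. a \<in> A \<Longrightarrow> b \<in> B \<Longrightarrow> f a b \<in> carrier G"
  shows "(\<Oplus>a\<in>A. \<Oplus>b\<in>B. f a b) = (\<Oplus>b\<in>B. \<Oplus>a\<in>A. f a b)"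
  using assms(1,3)
proof (induction A)
  case empty
  then show ?case by simp
next
  case (insert x A)
  have "(\<Oplus>a\<in>insert x A. \<Oplus>b\<in>B. f a b) = (\<Oplus>b\<in>B. f x b) \<oplus> (\<Oplus>b\<in>B. \<Oplus>a\<in>A. f a b)"
    using insert by (subst finsum_insert) (auto simp: Pi_iff)
  also have "\<dots> = (\<Oplus>b\<in>B. f x b \<oplus> (\<Oplus>a\<in>A. f a b))"
    using insert by (subst finsum_addf) (auto simp: Pi_iff)
  also have "\<dots> = (\<Oplus>b\<in>B. \<Oplus>a\<in>insert x A. f a b)"
    using insert by (intro finsum_cong') (auto simp: Pi_iff)
  finally show ?case .
qed

text \<open>
  Matrices are extensional functions on pairs of indices, so that equality of matrices is equality
  of functions; the index set is a set and not a type because the size of the matrices is only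
  obtained from the embedding of the group scheme.
\<close>

definition matrix_ring :: "'i set \<Rightarrow> ('a, 'm) ring_scheme \<Rightarrow> ('i \<times> 'i \<Rightarrow> 'a) ring"
  where "matrix_ring I D = \<lparr>carrier = I \<times> I \<rightarrow>\<^sub>E carrier D,
    monoid.mult = (\<lambda>M N. \<lambda>(i, j) \<in> I \<times> I. \<Oplus>\<^bsub>D\<^esub>k\<in>I. M (i, k) \<otimes>\<^bsub>D\<^esub> N (k, j)),
    monoid.one = (\<lambda>(i, j) \<in> I \<times> I. if i = j then \<one>\<^bsub>D\<^esub> else \<zero>\<^bsub>D\<^esub>),
    ring.zero = (\<lambda>(i, j) \<in> I \<times> I. \<zero>\<^bsub>D\<^esub>),
    ring.add = (\<lambda>M N. \<lambda>(i, j) \<in> I \<times> I. M (i, j) \<oplus>\<^bsub>D\<^esub> N (i, j))\<rparr>"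

lemma (in ring) matrix_ring_is_ring:
  assumes I: "finite I"
  shows "ring (matrix_ring I R)"
proof (rule ringI)
  let ?M = "matrix_ring I R"
  have entry: "x (i, j) \<in> carrier R" if "x \<in> I \<times> I \<rightarrow>\<^sub>E carrier R" "i \<in> I" "j \<in> I" for x i j
    using that by (auto simp: PiE_mem)
  note ext = PiE_ext[of _ "I \<times> I" "\<lambda>_. carrier R"]
  show "abelian_group ?M"
  proof (rule abelian_groupI)
    fix x assume x: "x \<in> carrier ?M"
    have "x (i, j) \<in> carrier R" if "i \<in> I" "j \<in> I" for i j
      using x that by (auto simp: matrix_ring_def PiE_mem)
    then show "\<exists>y\<in>carrier ?M. y \<oplus>\<^bsub>?M\<^esub> x = \<zero>\<^bsub>?M\<^esub>"
      using x by (intro bexI[of _ "\<lambda>(i, j) \<in> I \<times> I. \<ominus> x (i, j)"])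
         (auto simp: matrix_ring_def PiE_mem l_neg intro!: ext split: if_splits)
  qed (auto simp: matrix_ring_def entry a_ac intro!: ext)
  show "Group.monoid ?M"
  proof (rule monoidI)
    fix x y z assume M: "x \<in> carrier ?M" "y \<in> carrier ?M" "z \<in> carrier ?M"
    have c: "x (i, j) \<in> carrier R" "y (i, j) \<in> carrier R" "z (i, j) \<in> carrier R"
      if "i \<in> I" "j \<in> I" for i j
      using M that by (auto simp: matrix_ring_def PiE_mem)
    have "(\<Oplus>k\<in>I. (\<Oplus>l\<in>I. x (i, l) \<otimes> y (l, k)) \<otimes> z (k, j))
        = (\<Oplus>l\<in>I. x (i, l) \<otimes> (\<Oplus>k\<in>I. y (l, k) \<otimes> z (k, j)))" if ij: "i \<in> I" "j \<in> I" for i j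
    proof -
      have "(\<Oplus>k\<in>I. (\<Oplus>l\<in>I. x (i, l) \<otimes> y (l, k)) \<otimes> z (k, j))
          = (\<Oplus>k\<in>I. \<Oplus>l\<in>I. x (i, l) \<otimes> y (l, k) \<otimes> z (k, j))"
        using c ij I by (intro finsum_cong') (auto simp: finsum_ldistr)
      also have "\<dots> = (\<Oplus>l\<in>I. \<Oplus>k\<in>I. x (i, l) \<otimes> y (l, k) \<otimes> z (k, j))"
        using c ij I by (intro finsum_swap) auto
      also have "\<dots> = (\<Oplus>l\<in>I. x (i, l) \<otimes> (\<Oplus>k\<in>I. y (l, k) \<otimes> z (k, j)))"
        using c ij I by (intro finsum_cong') (auto simp: finsum_rdistr m_assoc Pi_iff intro!: finsum_cong')
      finally show ?thesis .
    qed
    then show "x \<otimes>\<^bsub>?M\<^esub> y \<otimes>\<^bsub>?M\<^esub> z = x \<otimes>\<^bsub>?M\<^esub> (y \<otimes>\<^bsub>?M\<^esub> z)"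
      using c I by (intro ext) (auto simp: matrix_ring_def Pi_iff cong: finsum_cong)
  next
    fix x assume x: "x \<in> carrier ?M"
    have c: "x (i, j) \<in> carrier R" if "i \<in> I" "j \<in> I" for i j
      using x that by (auto simp: matrix_ring_def PiE_mem)
    have 1: "(\<Oplus>k\<in>I. (if i = k then \<one> else \<zero>) \<otimes> x (k, j)) = x (i, j)" if "i \<in> I" "j \<in> I" for i j
    proof -
      have "(\<Oplus>k\<in>I. (if i = k then \<one> else \<zero>) \<otimes> x (k, j)) = (\<Oplus>k\<in>I. if i = k then x (k, j) else \<zero>)"
        using c that by (intro finsum_cong') auto
      then show ?thesis using finsum_singleton[of i I "\<lambda>k. x (k, j)"] c that I by auto
    qed
    have 2: "(\<Oplus>k\<in>I. x (i, k) \<otimes> (if k = j then \<one> else \<zero>)) = x (i, j)" if "i \<in> I" "j \<in> I" for i j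
    proof -
      have "(\<Oplus>k\<in>I. x (i, k) \<otimes> (if k = j then \<one> else \<zero>)) = (\<Oplus>k\<in>I. if j = k then x (i, k) else \<zero>)"
        using c that by (intro finsum_cong') auto
      then show ?thesis using finsum_singleton[of j I "\<lambda>k. x (i, k)"] c that I by auto
    qed
    show "\<one>\<^bsub>?M\<^esub> \<otimes>\<^bsub>?M\<^esub> x = x" "x \<otimes>\<^bsub>?M\<^esub> \<one>\<^bsub>?M\<^esub> = x"
      using 1 2 x c I
      by (auto intro!: ext simp: matrix_ring_def Pi_iff PiE_mem cong: finsum_cong split: if_splits)
  qed (use I in \<open>auto simp: matrix_ring_def entry intro!: finsum_closed\<close>)
  fix x y z assume M: "x \<in> carrier ?M" "y \<in> carrier ?M" "z \<in> carrier ?M"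
  have c: "x (i, j) \<in> carrier R" "y (i, j) \<in> carrier R" "z (i, j) \<in> carrier R"
    if "i \<in> I" "j \<in> I" for i j
    using M that by (auto simp: matrix_ring_def PiE_mem)
  show "(x \<oplus>\<^bsub>?M\<^esub> y) \<otimes>\<^bsub>?M\<^esub> z = x \<otimes>\<^bsub>?M\<^esub> z \<oplus>\<^bsub>?M\<^esub> y \<otimes>\<^bsub>?M\<^esub> z"
    using c I by (intro ext) (auto simp: matrix_ring_def Pi_iff l_distr finsum_addf cong: finsum_cong)
  show "z \<otimes>\<^bsub>?M\<^esub> (x \<oplus>\<^bsub>?M\<^esub> y) = z \<otimes>\<^bsub>?M\<^esub> x \<oplus>\<^bsub>?M\<^esub> z \<otimes>\<^bsub>?M\<^esub> y"
    using c I by (intro ext) (auto simp: matrix_ring_def Pi_iff r_distr finsum_addf cong: finsum_cong)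
qed

text \<open>
  The group-theoretic core. Cancelling \<open>P\<close> in the relations \<open>sym\<close> gives \<open>Z1 = Z0 u\<close> and \<open>Z2 = Z0 v\<close> with
  \<open>u = X1 X0\<^sup>-\<^sup>1\<close> and \<open>v = X2 X0\<^sup>-\<^sup>1\<close>. Substituted into \<open>hor\<close> this leaves \<open>u\<^sup>2 = v\<^sup>2\<close>, with \<open>u\<close> and \<open>v\<close>
  near the identity.
\<close>

lemma (in ring) equal_of_matrix_relations:
  assumes p: "odd p" "[((p::nat) ^ n)] \<cdot> \<one> = \<zero>"
    and units: "P \<in> Units R" "Z0 \<in> Units R" "X0 \<in> Units R"
    and carr: "Z1 \<in> carrier R" "Z2 \<in> carrier R" "X1 \<in> carrier R" "X2 \<in> carrier R"
    and a: "a1 \<in> carrier R" "X1 = X0 \<oplus> [p] \<cdot> a1" "a2 \<in> carrier R" "X2 = X0 \<oplus> [p] \<cdot> a2"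
    and sym: "P \<otimes> Z0 \<otimes> X1 = P \<otimes> Z1 \<otimes> X0" "P \<otimes> Z0 \<otimes> X2 = P \<otimes> Z2 \<otimes> X0"
    and hor: "P \<otimes> Z1 \<otimes> X1 = P \<otimes> Z2 \<otimes> X2"
  shows "X1 = X2"
proof -
  note c = carr a(1,3) units[THEN Units_closed]
  have Y: "inv X0 \<in> carrier R" "X0 \<otimes> inv X0 = \<one>" "inv X0 \<otimes> X0 = \<one>" using units(3) by auto
  have near: "S \<otimes> inv X0 = \<one> \<oplus> [p] \<cdot> (e \<otimes> inv X0)" if "e \<in> carrier R" "S = X0 \<oplus> [p] \<cdot> e" for S e
    using that Y c by (simp add: l_distr add_pow_ldistr)
  have Z: "Z = Z0 \<otimes> (S \<otimes> inv X0)"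
    if "Z \<in> carrier R" "S \<in> carrier R" "P \<otimes> Z0 \<otimes> S = P \<otimes> Z \<otimes> X0" for S Z
  proof -
    have "P \<otimes> (Z0 \<otimes> S) = P \<otimes> (Z \<otimes> X0)" using that c by (simp add: m_assoc)
    then have eq: "Z0 \<otimes> S = Z \<otimes> X0" using units(1) that c by (simp add: Units_l_cancel)
    have "Z0 \<otimes> (S \<otimes> inv X0) = Z \<otimes> X0 \<otimes> inv X0" using that c Y by (simp add: eq[symmetric] m_assoc)
    then show ?thesis using that c Y by (simp add: m_assoc)
  qed
  define u v where "u = X1 \<otimes> inv X0" and "v = X2 \<otimes> inv X0"
  have uv: "u \<in> carrier R" "v \<in> carrier R" using c Y by (simp_all add: u_def v_def)
  have X: "X1 = u \<otimes> X0" "X2 = v \<otimes> X0" using c Y by (simp_all add: u_def v_def m_assoc)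
  have Z12: "Z1 = Z0 \<otimes> u" "Z2 = Z0 \<otimes> v"
    unfolding u_def v_def using Z c sym by blast+
  have "P \<otimes> (Z0 \<otimes> (u \<otimes> u \<otimes> X0)) = P \<otimes> (Z0 \<otimes> (v \<otimes> v \<otimes> X0))"
    using hor uv c by (simp add: X Z12 m_assoc)
  then have "u \<otimes> u \<otimes> X0 = v \<otimes> v \<otimes> X0"
    using units(1,2) uv c by (simp add: Units_l_cancel)
  then have "u \<otimes> u \<otimes> X0 \<otimes> inv X0 = v \<otimes> v \<otimes> X0 \<otimes> inv X0" by simp
  then have sq: "u \<otimes> u = v \<otimes> v" using uv c Y by (simp add: m_assoc)
  have "u = v"
    using square_root_unique_near_one[OF p _ _ near near sq[unfolded u_def v_def]] a c Y
    by (simp add: u_def v_def)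
  then show ?thesis using X by simp
qed

lemma (in ring) matrix_ring_nat_multiple:
  assumes "finite I" "M \<in> carrier (matrix_ring I R)" "i \<in> I" "j \<in> I"
  shows "([(k::nat)] \<cdot>\<^bsub>matrix_ring I R\<^esub> M) (i, j) = [k] \<cdot> (M (i, j))"
proof -
  interpret M: ring "matrix_ring I R" by (rule matrix_ring_is_ring) fact
  show ?thesis
  proof (induction k)
    case 0
    have "\<zero>\<^bsub>matrix_ring I R\<^esub> (i, j) = \<zero>" using assms by (simp add: matrix_ring_def)
    then show ?case by simp
  next
    case (Suc k)
    have "([Suc k] \<cdot>\<^bsub>matrix_ring I R\<^esub> M) (i, j)
        = ([k] \<cdot>\<^bsub>matrix_ring I R\<^esub> M \<oplus>\<^bsub>matrix_ring I R\<^esub> M) (i, j)" by simp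
    also have "\<dots> = ([k] \<cdot>\<^bsub>matrix_ring I R\<^esub> M) (i, j) \<oplus> M (i, j)"
      using assms by (simp add: matrix_ring_def)
    finally show ?case using Suc by simp
  qed
qed

lemma (in ring) matrix_ring_characteristic:
  assumes I: "finite I" and k: "[(k::nat)] \<cdot> \<one> = \<zero>"
  shows "[k] \<cdot>\<^bsub>matrix_ring I R\<^esub> \<one>\<^bsub>matrix_ring I R\<^esub> = \<zero>\<^bsub>matrix_ring I R\<^esub>"
    (is "?L = ?R")
proof -
  interpret M: ring "matrix_ring I R" by (rule matrix_ring_is_ring) fact
  have c: "?L \<in> carrier (matrix_ring I R)" "?R \<in> carrier (matrix_ring I R)" by simp_all
  show ?thesis
  proof (rule PiE_ext)
    show "?L \<in> I \<times> I \<rightarrow>\<^sub>E carrier R" "?R \<in> I \<times> I \<rightarrow>\<^sub>E carrier R"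
      using c by (simp_all add: matrix_ring_def)
    fix ij assume "ij \<in> I \<times> I"
    then obtain i j where ij: "ij = (i, j)" "i \<in> I" "j \<in> I" by auto
    have "?L (i, j) = [k] \<cdot> (\<one>\<^bsub>matrix_ring I R\<^esub> (i, j))"
      by (rule matrix_ring_nat_multiple[OF I M.one_closed ij(2,3)])
    also have "\<dots> = ?R (i, j)" using ij k by (simp add: matrix_ring_def)
    finally show "?L ij = ?R ij" by (simp add: ij)
  qed
qed

section \<open>Tensor products of algebras\<close>

text \<open>
  The tensor product is an extension of the quotient ring record by a scalar multiplication; this
  lemma carries the ring axioms over.
\<close>

lemma cring_transfer:
  fixes S :: "('a, 'm) ring_scheme" and T :: "('a, 'n) ring_scheme"
  assumes "cring S" "carrier T = carrier S" "monoid.mult T = monoid.mult S"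
    "monoid.one T = monoid.one S" "ring.zero T = ring.zero S" "ring.add T = ring.add S"
  shows "cring T"
proof -
  interpret S: cring S by fact
  note eqs = assms(2-)
  show ?thesis
  proof (rule cringI)
    show "abelian_group T"
    proof (rule abelian_groupI)
      fix x assume "x \<in> carrier T"
      then show "\<exists>y\<in>carrier T. y \<oplus>\<^bsub>T\<^esub> x = \<zero>\<^bsub>T\<^esub>"
        unfolding eqs using S.l_neg[of x] S.a_inv_closed[of x] by blast
    qed (simp_all add: eqs S.a_ac)
    show "comm_monoid T"
      by (rule comm_monoidI) (simp_all add: eqs S.m_ac)
  qed (simp add: eqs S.l_distr)
qed

lemma cring_r_distr:
  assumes "cring A" "x \<in> carrier A" "y \<in> carrier A" "z \<in> carrier A"
  shows "z \<otimes>\<^bsub>A\<^esub> (x \<oplus>\<^bsub>A\<^esub> y) = z \<otimes>\<^bsub>A\<^esub> x \<oplus>\<^bsub>A\<^esub> z \<otimes>\<^bsub>A\<^esub> y"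
proof -
  interpret cring A by fact
  show ?thesis using assms(2-) by (rule r_distr)
qed

lemma pair_ring_simps:
  "carrier (pair_ring A B) = {c. Poly_Mapping.keys c \<subseteq> carrier A \<times> carrier B}"
  "\<zero>\<^bsub>pair_ring A B\<^esub> = 0"
  "u \<oplus>\<^bsub>pair_ring A B\<^esub> v = u + v"
  "\<one>\<^bsub>pair_ring A B\<^esub> = frag_of (\<one>\<^bsub>A\<^esub>, \<one>\<^bsub>B\<^esub>)"
  by (simp_all add: pair_ring_def)

lemma pair_mult_of [simp]:
  "frag_of (a, b) \<otimes>\<^bsub>pair_ring A B\<^esub> frag_of (c, d) = frag_of (a \<otimes>\<^bsub>A\<^esub> c, b \<otimes>\<^bsub>B\<^esub> d)"
  by (simp add: pair_ring_def)

lemma pair_mult_0 [simp]: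
  "0 \<otimes>\<^bsub>pair_ring A B\<^esub> v = 0" "v \<otimes>\<^bsub>pair_ring A B\<^esub> 0 = 0"
  by (simp_all add: pair_ring_def frag_extend_eq_0)

lemma pair_mult_diff:
  "(u - v) \<otimes>\<^bsub>pair_ring A B\<^esub> w = u \<otimes>\<^bsub>pair_ring A B\<^esub> w - v \<otimes>\<^bsub>pair_ring A B\<^esub> w"
  "w \<otimes>\<^bsub>pair_ring A B\<^esub> (u - v) = w \<otimes>\<^bsub>pair_ring A B\<^esub> u - w \<otimes>\<^bsub>pair_ring A B\<^esub> v"
proof -
  show "(u - v) \<otimes>\<^bsub>pair_ring A B\<^esub> w = u \<otimes>\<^bsub>pair_ring A B\<^esub> w - v \<otimes>\<^bsub>pair_ring A B\<^esub> w"
    by (simp add: pair_ring_def frag_extend_diff)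
  have cmul_diff: "frag_cmul c (a - b) = frag_cmul c a - frag_cmul c b" for c and a b :: "'x \<Rightarrow>\<^sub>0 int"
    using frag_cmul_distrib2[of c "a - b" b] by (simp add: eq_diff_eq)
  show "w \<otimes>\<^bsub>pair_ring A B\<^esub> (u - v) = w \<otimes>\<^bsub>pair_ring A B\<^esub> u - w \<otimes>\<^bsub>pair_ring A B\<^esub> v"
    by (simp add: pair_ring_def frag_extend_diff)
       (simp add: frag_extend_def cmul_diff sum_subtractf)
qed

lemma pair_mult_add:
  "(u + v) \<otimes>\<^bsub>pair_ring A B\<^esub> w = u \<otimes>\<^bsub>pair_ring A B\<^esub> w + v \<otimes>\<^bsub>pair_ring A B\<^esub> w"
  "w \<otimes>\<^bsub>pair_ring A B\<^esub> (u + v) = w \<otimes>\<^bsub>pair_ring A B\<^esub> u + w \<otimes>\<^bsub>pair_ring A B\<^esub> v"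
  using pair_mult_diff(1)[where u = "u + v" and v = v and A = A and B = B and w = w]
    pair_mult_diff(2)[where u = "u + v" and v = v and A = A and B = B and w = w]
  by (simp_all only: add_diff_cancel_right' eq_diff_eq)

text \<open>
  The pairs generate the monoid ring additively, and both its multiplication and the maps out of it
  are additive; identities and closure properties reduce to pairs by this rule.
\<close>

lemma pair_ring_induct [consumes 1, case_names zero of diff]:
  assumes "z \<in> carrier (pair_ring A B)"
    and "P 0" and "\<And>a b. a \<in> carrier A \<Longrightarrow> b \<in> carrier B \<Longrightarrow> P (frag_of (a, b))"
    and "\<And>u v. P u \<Longrightarrow> P v \<Longrightarrow> P (u - v)"
  shows "P z"
  using assms by (intro frag_induction[of z "carrier A \<times> carrier B" P]) (auto simp: pair_ring_simps)

lemma pair_ring_add_monoid: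
  "add_monoid (pair_ring A B) = free_Abelian_group (carrier A \<times> carrier B)"
  by (simp add: pair_ring_def free_Abelian_group_def)

lemma pair_ring_cring:
  assumes "cring A" "cring B"
  shows "cring (pair_ring A B)"
proof -
  interpret A: cring A by fact
  interpret B: cring B by fact
  let ?P = "pair_ring A B"
  have diff: "u - v \<in> carrier ?P" if "u \<in> carrier ?P" "v \<in> carrier ?P" for u v
    using that keys_diff[of u v] by (auto simp: pair_ring_simps)
  have closed: "u \<otimes>\<^bsub>?P\<^esub> v \<in> carrier ?P" if u: "u \<in> carrier ?P" and v: "v \<in> carrier ?P" for u v
    using u
  proof (induction rule: pair_ring_induct)
    case (of a b)
    show ?case using v
    proof (induction rule: pair_ring_induct)
      case (of c d)
      then show ?case using \<open>a \<in> carrier A\<close> \<open>b \<in> carrier B\<close> by (simp add: pair_ring_simps)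
    qed (simp_all add: pair_mult_diff diff, simp add: pair_ring_simps)
  qed (simp_all add: pair_mult_diff diff, simp add: pair_ring_simps)
  have comm: "u \<otimes>\<^bsub>?P\<^esub> v = v \<otimes>\<^bsub>?P\<^esub> u" if u: "u \<in> carrier ?P" and v: "v \<in> carrier ?P" for u v
    using u
  proof (induction rule: pair_ring_induct)
    case (of a b)
    show ?case using v
    proof (induction rule: pair_ring_induct)
      case (of c d)
      then show ?case using \<open>a \<in> carrier A\<close> \<open>b \<in> carrier B\<close> by (simp add: A.m_comm B.m_comm)
    qed (simp_all add: pair_mult_diff)
  qed (simp_all add: pair_mult_diff)
  have assoc: "u \<otimes>\<^bsub>?P\<^esub> v \<otimes>\<^bsub>?P\<^esub> w = u \<otimes>\<^bsub>?P\<^esub> (v \<otimes>\<^bsub>?P\<^esub> w)"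
    if u: "u \<in> carrier ?P" and v: "v \<in> carrier ?P" and w: "w \<in> carrier ?P" for u v w
    using u
  proof (induction rule: pair_ring_induct)
    case (of a b)
    note ab = of
    show ?case using v
    proof (induction rule: pair_ring_induct)
      case (of c d)
      note cd = of
      show ?case using w
      proof (induction rule: pair_ring_induct)
        case (of e f)
        then show ?case using ab cd by (simp add: A.m_assoc B.m_assoc)
      qed (simp_all add: pair_mult_diff)
    qed (simp_all add: pair_mult_diff)
  qed (simp_all add: pair_mult_diff)
  have one: "\<one>\<^bsub>?P\<^esub> \<otimes>\<^bsub>?P\<^esub> u = u" if u: "u \<in> carrier ?P" for u
    using u
  proof (induction rule: pair_ring_induct)
    case (of a b)
    then show ?case by (simp add: pair_ring_simps(4))
  qed (simp_all add: pair_mult_diff)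
  show ?thesis
  proof (rule cringI)
    show "abelian_group ?P"
      by (rule comm_group_abelian_groupI)
         (simp only: pair_ring_add_monoid abelian_free_Abelian_group)
    show "comm_monoid ?P"
      by (rule comm_monoidI) (use closed assoc one comm in \<open>auto simp: pair_ring_simps(4)\<close>, simp add: pair_ring_simps)
  qed (simp add: pair_mult_add pair_ring_simps(3))
qed

locale two_algebras = A: algebra R A + B: algebra R B
  for R :: "('r, 'k) ring_scheme" and A :: "('r, 'a, 'm) module_scheme" and B :: "('r, 'b, 'n) module_scheme"
begin

abbreviation "Pr \<equiv> pair_ring A B"
abbreviation "K \<equiv> tensor_ker R A B"
abbreviation "T \<equiv> tensor R A B"

lemma Pr_cring: "cring Pr"
  by (rule pair_ring_cring[OF A.M_cring B.M_cring])

sublocale Pr: cring Pr by (rule Pr_cring)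

lemma tensor_rels_carrier: "tensor_rels R A B \<subseteq> carrier Pr"
proof
  have diff: "u - v \<in> carrier Pr" if "u \<in> carrier Pr" "v \<in> carrier Pr" for u v
    using that keys_diff[of u v] by (auto simp: pair_ring_simps)
  have of: "frag_of (a, b) \<in> carrier Pr" if "a \<in> carrier A" "b \<in> carrier B" for a b
    using that by (simp add: pair_ring_simps)
  fix x assume "x \<in> tensor_rels R A B"
  then show "x \<in> carrier Pr" unfolding tensor_rels_def
    by (auto intro!: diff of)
qed

lemma tensor_rels_cases [consumes 1, case_names left right scalar]:
  assumes "x \<in> tensor_rels R A B"
  obtains m m' n where "m \<in> carrier A" "m' \<in> carrier A" "n \<in> carrier B"
      "x = frag_of (m \<oplus>\<^bsub>A\<^esub> m', n) - frag_of (m, n) - frag_of (m', n)"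
    | m n n' where "m \<in> carrier A" "n \<in> carrier B" "n' \<in> carrier B"
      "x = frag_of (m, n \<oplus>\<^bsub>B\<^esub> n') - frag_of (m, n) - frag_of (m, n')"
    | r m n where "r \<in> carrier R" "m \<in> carrier A" "n \<in> carrier B"
      "x = frag_of (r \<odot>\<^bsub>A\<^esub> m, n) - frag_of (m, r \<odot>\<^bsub>B\<^esub> n)"
  using assms unfolding tensor_rels_def
  by (elim UnE CollectE exE conjE) (erule (3) that)+

lemma tensor_rels_intros:
  "m \<in> carrier A \<Longrightarrow> m' \<in> carrier A \<Longrightarrow> n \<in> carrier B \<Longrightarrow>
    frag_of (m \<oplus>\<^bsub>A\<^esub> m', n) - frag_of (m, n) - frag_of (m', n) \<in> tensor_rels R A B"
  "m \<in> carrier A \<Longrightarrow> n \<in> carrier B \<Longrightarrow> n' \<in> carrier B \<Longrightarrow>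
    frag_of (m, n \<oplus>\<^bsub>B\<^esub> n') - frag_of (m, n) - frag_of (m, n') \<in> tensor_rels R A B"
  "r \<in> carrier R \<Longrightarrow> m \<in> carrier A \<Longrightarrow> n \<in> carrier B \<Longrightarrow>
    frag_of (r \<odot>\<^bsub>A\<^esub> m, n) - frag_of (m, r \<odot>\<^bsub>B\<^esub> n) \<in> tensor_rels R A B"
  unfolding tensor_rels_def
  subgoal by (rule UnI1, rule UnI1) blast
  subgoal by (rule UnI1, rule UnI2) blast
  subgoal by (rule UnI2) blast
  done

lemma tensor_rels_mult:
  assumes "x \<in> tensor_rels R A B" "c \<in> carrier A" "d \<in> carrier B"
  shows "frag_of (c, d) \<otimes>\<^bsub>Pr\<^esub> x \<in> tensor_rels R A B"
proof -
  note m_comm = comm_monoid.m_comm[OF cring.axioms(2)]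
  have sA: "c \<otimes>\<^bsub>A\<^esub> (r \<odot>\<^bsub>A\<^esub> m) = r \<odot>\<^bsub>A\<^esub> (c \<otimes>\<^bsub>A\<^esub> m)" if "r \<in> carrier R" "m \<in> carrier A" for r m
    using assms that A.smult_assoc2[of r m c]
    by (simp add: m_comm[OF A.M_cring, of c "r \<odot>\<^bsub>A\<^esub> m"] m_comm[OF A.M_cring, of c m])
  have sB: "d \<otimes>\<^bsub>B\<^esub> (r \<odot>\<^bsub>B\<^esub> m) = r \<odot>\<^bsub>B\<^esub> (d \<otimes>\<^bsub>B\<^esub> m)" if "r \<in> carrier R" "m \<in> carrier B" for r m
    using assms that B.smult_assoc2[of r m d]
    by (simp add: m_comm[OF B.M_cring, of d "r \<odot>\<^bsub>B\<^esub> m"] m_comm[OF B.M_cring, of d m])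
  show ?thesis
    using assms(1)
  proof (cases rule: tensor_rels_cases)
    case (left m m' n)
    have "frag_of (c, d) \<otimes>\<^bsub>Pr\<^esub> x = frag_of (c \<otimes>\<^bsub>A\<^esub> m \<oplus>\<^bsub>A\<^esub> c \<otimes>\<^bsub>A\<^esub> m', d \<otimes>\<^bsub>B\<^esub> n)
        - frag_of (c \<otimes>\<^bsub>A\<^esub> m, d \<otimes>\<^bsub>B\<^esub> n) - frag_of (c \<otimes>\<^bsub>A\<^esub> m', d \<otimes>\<^bsub>B\<^esub> n)"
      unfolding left(4) pair_mult_diff pair_mult_of
      using left(1-3) assms by (simp only: cring_r_distr[OF A.M_cring])
    then show ?thesis
      by (simp only:) (rule tensor_rels_intros; use left(1-3) assms(2,3) in auto)
  next
    case (right m n n')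
    have "frag_of (c, d) \<otimes>\<^bsub>Pr\<^esub> x = frag_of (c \<otimes>\<^bsub>A\<^esub> m, d \<otimes>\<^bsub>B\<^esub> n \<oplus>\<^bsub>B\<^esub> d \<otimes>\<^bsub>B\<^esub> n')
        - frag_of (c \<otimes>\<^bsub>A\<^esub> m, d \<otimes>\<^bsub>B\<^esub> n) - frag_of (c \<otimes>\<^bsub>A\<^esub> m, d \<otimes>\<^bsub>B\<^esub> n')"
      unfolding right(4) pair_mult_diff pair_mult_of
      using right(1-3) assms by (simp only: cring_r_distr[OF B.M_cring])
    then show ?thesis
      by (simp only:) (rule tensor_rels_intros; use right(1-3) assms(2,3) in auto)
  next
    case (scalar r m n)
    have "frag_of (c, d) \<otimes>\<^bsub>Pr\<^esub> x = frag_of (r \<odot>\<^bsub>A\<^esub> (c \<otimes>\<^bsub>A\<^esub> m), d \<otimes>\<^bsub>B\<^esub> n)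
        - frag_of (c \<otimes>\<^bsub>A\<^esub> m, r \<odot>\<^bsub>B\<^esub> (d \<otimes>\<^bsub>B\<^esub> n))"
      unfolding scalar(4) pair_mult_diff pair_mult_of using scalar(1-3) by (simp only: sA sB)
    then show ?thesis
      by (simp only:) (rule tensor_rels_intros; use scalar(1-3) assms(2,3) in auto)
  qed
qed

lemma K_subgroup: "subgroup K (add_monoid Pr)"
  unfolding pair_ring_add_monoid tensor_ker_def
  by (rule group.generate_is_subgroup) (use tensor_rels_carrier in \<open>auto simp: pair_ring_simps\<close>)

lemma K_induct [consumes 1, case_names zero rel uminus add]:
  assumes "x \<in> K" "P 0" "\<And>x. x \<in> tensor_rels R A B \<Longrightarrow> P x"
    "\<And>x. x \<in> tensor_rels R A B \<Longrightarrow> P (- x)"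
    "\<And>x y. x \<in> K \<Longrightarrow> y \<in> K \<Longrightarrow> P x \<Longrightarrow> P y \<Longrightarrow> P (x + y)"
  shows "P x"
  using assms(1) unfolding tensor_ker_def
proof (induction rule: generate.induct)
  case (inv h)
  then have "Poly_Mapping.keys h \<subseteq> carrier A \<times> carrier B"
    using tensor_rels_carrier by (auto simp: pair_ring_simps)
  then show ?case using assms(4)[OF inv] by simp
next
  case (eng x y)
  then show ?case using assms(5)[of x y] unfolding tensor_ker_def by simp
qed (simp_all add: assms(2,3))

lemma rels_in_K: "x \<in> tensor_rels R A B \<Longrightarrow> x \<in> K"
  unfolding tensor_ker_def by (rule generate.incl)

lemma Pr_uminus: "z \<in> carrier Pr \<Longrightarrow> \<ominus>\<^bsub>Pr\<^esub> z = - z"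
  by (rule Pr.minus_equality) (auto simp: pair_ring_simps)

lemma Pr_minus: "u \<in> carrier Pr \<Longrightarrow> v \<in> carrier Pr \<Longrightarrow> u \<ominus>\<^bsub>Pr\<^esub> v = u - v"
  by (simp add: a_minus_def Pr_uminus pair_ring_simps(3))

lemma Pr_diff: "u \<in> carrier Pr \<Longrightarrow> v \<in> carrier Pr \<Longrightarrow> u - v \<in> carrier Pr"
  using Pr.minus_closed[of u v] by (simp add: Pr_minus)

lemma K_additive: "additive_subgroup K Pr"
  by (rule additive_subgroupI) (rule K_subgroup)

lemma K_closed: "0 \<in> K" "x \<in> K \<Longrightarrow> y \<in> K \<Longrightarrow> x + y \<in> K" "x \<in> K \<Longrightarrow> - x \<in> K"
    "x \<in> K \<Longrightarrow> y \<in> K \<Longrightarrow> x - y \<in> K"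
proof -
  interpret additive_subgroup K Pr by (rule K_additive)
  show "0 \<in> K" using zero_closed by (simp add: pair_ring_simps)
  show add: "x + y \<in> K" if "x \<in> K" "y \<in> K" for x y
    using a_closed[OF that] by (simp add: pair_ring_simps)
  show uminus: "- x \<in> K" if "x \<in> K" for x
    using a_inv_closed[OF that] that a_subset by (auto simp: Pr_uminus)
  show "x - y \<in> K" if "x \<in> K" "y \<in> K" using add[OF that(1) uminus[OF that(2)]] by simp
qed

text \<open>
  Multiplying a defining relation of the tensor product by a pair gives a defining relation again
  (\<open>tensor_rels_mult\<close>); additivity in both factors does the rest.
\<close>

lemma K_ideal: "ideal K Pr"
proof -
  have "frag_of (c, d) \<otimes>\<^bsub>Pr\<^esub> x \<in> K" if "x \<in> K" "c \<in> carrier A" "d \<in> carrier B" for c d x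
    using that(1)
  proof (induction rule: K_induct)
    case (uminus x)
    have "frag_of (c, d) \<otimes>\<^bsub>Pr\<^esub> (0 - x) = - (frag_of (c, d) \<otimes>\<^bsub>Pr\<^esub> x)"
      by (subst pair_mult_diff) simp
    with uminus that show ?case using K_closed(3) tensor_rels_mult rels_in_K by simp
  qed (use that in \<open>auto simp: K_closed pair_mult_add tensor_rels_mult rels_in_K\<close>)
  note * = this
  have l: "z \<otimes>\<^bsub>Pr\<^esub> x \<in> K" if "x \<in> K" "z \<in> carrier Pr" for x z
    using that(2)
    by (induction rule: pair_ring_induct) (auto simp: K_closed pair_mult_diff that *)
  show ?thesis
  proof (rule idealI)
    show "ring Pr" by (rule Pr.ring_axioms)
    show "subgroup K (add_monoid Pr)" by (rule K_subgroup)
    fix a x assume "a \<in> K" "x \<in> carrier Pr"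
    then show "x \<otimes>\<^bsub>Pr\<^esub> a \<in> K" "a \<otimes>\<^bsub>Pr\<^esub> x \<in> K"
      using l Pr.m_comm[of a x] additive_subgroup.a_subset[OF K_additive] by auto
  qed
qed

sublocale KI: ideal K Pr by (rule K_ideal)

lemma coset_eq_iff:
  assumes "u \<in> carrier Pr" "v \<in> carrier Pr"
  shows "K +>\<^bsub>Pr\<^esub> u = K +>\<^bsub>Pr\<^esub> v \<longleftrightarrow> u - v \<in> K"
  using Pr.quotient_eq_iff_same_a_r_cos[OF K_ideal assms] by (simp add: Pr_minus assms)

lemma tensor_cring: "cring T"
  by (rule cring_transfer[OF KI.quotient_is_cring[OF Pr_cring]]) (simp_all add: tensor_def Let_def)

sublocale T: cring T by (rule tensor_cring)

lemma coset_ring_hom: "(+>\<^bsub>Pr\<^esub>) K \<in> ring_hom Pr T"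
  using KI.rcos_ring_hom by (simp add: ring_hom_def tensor_def Let_def)

lemma carrier_T: "carrier T = (+>\<^bsub>Pr\<^esub>) K ` carrier Pr"
  by (auto simp: tensor_def Let_def FactRing_def A_RCOSETS_def')

lemma frag_of_Pr: "a \<in> carrier A \<Longrightarrow> b \<in> carrier B \<Longrightarrow> frag_of (a, b) \<in> carrier Pr"
  by (simp add: pair_ring_simps)

lemma pure_tensor_mult:
  assumes "a \<in> carrier A" "b \<in> carrier B" "c \<in> carrier A" "d \<in> carrier B"
  shows "pure_tensor R A B a b \<otimes>\<^bsub>T\<^esub> pure_tensor R A B c d
    = pure_tensor R A B (a \<otimes>\<^bsub>A\<^esub> c) (b \<otimes>\<^bsub>B\<^esub> d)"
  using ring_hom_mult[OF coset_ring_hom, of "frag_of (a, b)" "frag_of (c, d)"] assms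
  by (simp add: pure_tensor_def frag_of_Pr)

lemma pure_tensor_closed:
  "a \<in> carrier A \<Longrightarrow> b \<in> carrier B \<Longrightarrow> pure_tensor R A B a b \<in> carrier T"
  by (auto simp: carrier_T pure_tensor_def frag_of_Pr)

lemma coset_eq_add:
  assumes "x \<in> carrier Pr" "y \<in> carrier Pr" "z \<in> carrier Pr" "x - y - z \<in> K"
  shows "K +>\<^bsub>Pr\<^esub> x = (K +>\<^bsub>Pr\<^esub> y) \<oplus>\<^bsub>T\<^esub> (K +>\<^bsub>Pr\<^esub> z)"
  using assms ring_hom_add[OF coset_ring_hom assms(2,3)] coset_eq_iff[of x "y + z"]
    Pr.a_closed[OF assms(2,3)]
  by (simp add: pair_ring_simps(3) diff_diff_eq)

lemma pure_tensor_add_left: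
  assumes "a \<in> carrier A" "a' \<in> carrier A" "b \<in> carrier B"
  shows "pure_tensor R A B (a \<oplus>\<^bsub>A\<^esub> a') b = pure_tensor R A B a b \<oplus>\<^bsub>T\<^esub> pure_tensor R A B a' b"
  unfolding pure_tensor_def
  by (rule coset_eq_add) (use assms in \<open>auto intro: frag_of_Pr rels_in_K tensor_rels_intros\<close>)

lemma pure_tensor_add_right:
  assumes "a \<in> carrier A" "b \<in> carrier B" "b' \<in> carrier B"
  shows "pure_tensor R A B a (b \<oplus>\<^bsub>B\<^esub> b') = pure_tensor R A B a b \<oplus>\<^bsub>T\<^esub> pure_tensor R A B a b'"
  unfolding pure_tensor_def
  by (rule coset_eq_add) (use assms in \<open>auto intro: frag_of_Pr rels_in_K tensor_rels_intros\<close>)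

lemma pure_tensor_one: "\<one>\<^bsub>T\<^esub> = pure_tensor R A B \<one>\<^bsub>A\<^esub> \<one>\<^bsub>B\<^esub>"
  by (simp add: tensor_def Let_def pure_tensor_def FactRing_def pair_ring_simps(4))

lemma pure_tensor_scalar:
  assumes "r \<in> carrier R" "a \<in> carrier A" "b \<in> carrier B"
  shows "pure_tensor R A B (r \<odot>\<^bsub>A\<^esub> a) b = pure_tensor R A B a (r \<odot>\<^bsub>B\<^esub> b)"
  using assms unfolding pure_tensor_def
  by (subst coset_eq_iff) (auto intro: frag_of_Pr rels_in_K tensor_rels_intros)

lemma tensor_inl_hom: "tensor_inl R A B \<in> ring_hom A T"
  by (rule ring_hom_memI)
    (simp_all add: tensor_inl_def pure_tensor_closed pure_tensor_mult pure_tensor_add_left pure_tensor_add_right pure_tensor_one)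

lemma tensor_inr_hom: "tensor_inr R A B \<in> ring_hom B T"
  by (rule ring_hom_memI)
    (simp_all add: tensor_inr_def pure_tensor_closed pure_tensor_mult pure_tensor_add_left pure_tensor_add_right pure_tensor_one)

lemma tensor_inl_inr_scalar:
  "r \<in> carrier R \<Longrightarrow> tensor_inl R A B (r \<odot>\<^bsub>A\<^esub> \<one>\<^bsub>A\<^esub>) = tensor_inr R A B (r \<odot>\<^bsub>B\<^esub> \<one>\<^bsub>B\<^esub>)"
  by (simp add: tensor_inl_def tensor_inr_def pure_tensor_scalar)

lemma tensor_smult_one:
  "r \<in> carrier R \<Longrightarrow> r \<odot>\<^bsub>T\<^esub> \<one>\<^bsub>T\<^esub> = tensor_inl R A B (r \<odot>\<^bsub>A\<^esub> \<one>\<^bsub>A\<^esub>)"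
proof -
  assume r: "r \<in> carrier R"
  have "r \<odot>\<^bsub>T\<^esub> \<one>\<^bsub>T\<^esub> = tensor_inl R A B (r \<odot>\<^bsub>A\<^esub> \<one>\<^bsub>A\<^esub>) \<otimes>\<^bsub>T\<^esub> \<one>\<^bsub>T\<^esub>"
    by (simp add: tensor_def Let_def tensor_inl_def)
  then show ?thesis using ring_hom_closed[OF tensor_inl_hom] r by simp
qed

end

text \<open>
  The additive extension of \<open>(a, b) \<mapsto> f a \<otimes> h b\<close> to the monoid ring of pairs; it is the function
  which \<open>tensor_lift\<close> applies to the members of a coset.
\<close>

definition pair_eval ::
    "('c, 'k) ring_scheme \<Rightarrow> ('a \<Rightarrow> 'c) \<Rightarrow> ('b \<Rightarrow> 'c) \<Rightarrow> (('a \<times> 'b) \<Rightarrow>\<^sub>0 int) \<Rightarrow> 'c"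
  where "pair_eval C f h z = (\<Oplus>\<^bsub>C\<^esub>x \<in> Poly_Mapping.keys z.
    [Poly_Mapping.lookup z x] \<cdot>\<^bsub>C\<^esub> (f (fst x) \<otimes>\<^bsub>C\<^esub> h (snd x)))"

text \<open>
  Two homomorphisms which induce the same map \<open>R \<rightarrow> C\<close>. No algebra structure on \<open>C\<close> is singled out, so
  that the homomorphisms may be semilinear with respect to \<open>\<phi>\<close>.
\<close>

locale tensor_target = two_algebras R A B + C: cring C
  for R :: "('r, 'k) ring_scheme" and A :: "('r, 'a, 'm) module_scheme"
    and B :: "('r, 'b, 'n) module_scheme" and C :: "('c, 'l) ring_scheme" +
  fixes f :: "'a \<Rightarrow> 'c" and h :: "'b \<Rightarrow> 'c"
  assumes f: "f \<in> ring_hom A C" and h: "h \<in> ring_hom B C"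
    and fh: "\<And>r. r \<in> carrier R \<Longrightarrow> f (r \<odot>\<^bsub>A\<^esub> \<one>\<^bsub>A\<^esub>) = h (r \<odot>\<^bsub>B\<^esub> \<one>\<^bsub>B\<^esub>)"
begin

abbreviation "ev \<equiv> pair_eval C f h"

lemmas f_simps = ring_hom_closed[OF f] ring_hom_mult[OF f] ring_hom_add[OF f] ring_hom_one[OF f]
lemmas h_simps = ring_hom_closed[OF h] ring_hom_mult[OF h] ring_hom_add[OF h] ring_hom_one[OF h]

lemma ev_superset:
  assumes "Poly_Mapping.keys z \<subseteq> S" "finite S" "S \<subseteq> carrier A \<times> carrier B"
  shows "ev z = (\<Oplus>\<^bsub>C\<^esub>x\<in>S. [Poly_Mapping.lookup z x] \<cdot>\<^bsub>C\<^esub> (f (fst x) \<otimes>\<^bsub>C\<^esub> h (snd x)))"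
  unfolding pair_eval_def
  using assms
  by (intro C.add.finprod_mono_neutral_cong_left)
     (auto simp: f_simps h_simps in_keys_iff int_pow_0[of "add_monoid C", folded add_pow_def])

lemma ev_closed: "z \<in> carrier Pr \<Longrightarrow> ev z \<in> carrier C"
  unfolding pair_eval_def
  by (intro C.finsum_closed) (auto simp: pair_ring_simps f_simps h_simps)

lemma ev_add:
  assumes "u \<in> carrier Pr" "v \<in> carrier Pr"
  shows "ev (u + v) = ev u \<oplus>\<^bsub>C\<^esub> ev v"
proof -
  define S where "S = Poly_Mapping.keys u \<union> Poly_Mapping.keys v"
  have S: "finite S" "S \<subseteq> carrier A \<times> carrier B" "Poly_Mapping.keys u \<subseteq> S"
      "Poly_Mapping.keys v \<subseteq> S" "Poly_Mapping.keys (u + v) \<subseteq> S"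
    using assms keys_add[of u v] by (auto simp: S_def pair_ring_simps)
  show ?thesis
    using S by (simp add: ev_superset[of _ S])
      (subst C.finsum_addf[symmetric], auto simp: lookup_add C.add.int_pow_mult f_simps h_simps Pi_iff
        intro!: C.finsum_cong')
qed

lemma ev_0: "ev 0 = \<zero>\<^bsub>C\<^esub>"
  by (simp add: pair_eval_def)

lemma ev_of: "a \<in> carrier A \<Longrightarrow> b \<in> carrier B \<Longrightarrow> ev (frag_of (a, b)) = f a \<otimes>\<^bsub>C\<^esub> h b"
  by (simp add: pair_eval_def f_simps h_simps)

lemma ev_diff:
  assumes "u \<in> carrier Pr" "v \<in> carrier Pr"
  shows "ev (u - v) = ev u \<ominus>\<^bsub>C\<^esub> ev v"
proof -
  have d: "u - v \<in> carrier Pr" using assms Pr.minus_closed[OF assms] by (simp add: Pr_minus)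
  have "ev (u - v) \<oplus>\<^bsub>C\<^esub> ev v = ev u" using ev_add[OF d assms(2)] by simp
  then show ?thesis
    using ev_closed[OF d] ev_closed[OF assms(1)] ev_closed[OF assms(2)]
    by (metis C.add.inv_solve_right' C.minus_eq)
qed

lemma ev_mult:
  assumes u: "u \<in> carrier Pr" and v: "v \<in> carrier Pr"
  shows "ev (u \<otimes>\<^bsub>Pr\<^esub> v) = ev u \<otimes>\<^bsub>C\<^esub> ev v"
proof -
  have "u \<in> carrier Pr \<and> ev (u \<otimes>\<^bsub>Pr\<^esub> v) = ev u \<otimes>\<^bsub>C\<^esub> ev v"
    using u
  proof (induction rule: pair_ring_induct)
    case (of a b)
    have "v \<in> carrier Pr \<and> ev (frag_of (a, b) \<otimes>\<^bsub>Pr\<^esub> v) = ev (frag_of (a, b)) \<otimes>\<^bsub>C\<^esub> ev v"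
      using v
    proof (induction rule: pair_ring_induct)
      case (of c d)
      then show ?case
        using \<open>a \<in> carrier A\<close> \<open>b \<in> carrier B\<close>
        by (simp add: ev_of f_simps h_simps frag_of_Pr C.m_ac)
    next
      case (diff x y)
      then show ?case
        using \<open>a \<in> carrier A\<close> \<open>b \<in> carrier B\<close> Pr_diff[of x y]
          Pr.m_closed[OF frag_of_Pr, of a b x] Pr.m_closed[OF frag_of_Pr, of a b y]
          C.r_minus[of "ev (frag_of (a, b))" "ev y"]
        by (simp add: ev_diff pair_mult_diff frag_of_Pr ev_closed a_minus_def C.r_distr)
    qed (use of in \<open>simp add: ev_0 ev_closed frag_of_Pr, simp add: pair_ring_simps\<close>)
    then show ?case using of by (simp add: frag_of_Pr)
  next
    case (diff x y)
    then show ?case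
      using v Pr_diff[of x y] Pr.m_closed[of x v] Pr.m_closed[of y v] C.l_minus[of "ev y" "ev v"]
      by (simp add: ev_diff pair_mult_diff ev_closed a_minus_def C.l_distr)
  qed (use v in \<open>simp add: ev_0 ev_closed, simp add: pair_ring_simps\<close>)
  then show ?thesis ..
qed

text \<open>
  The balancing relation is where the two maps have to agree on \<open>R\<close>: moving a scalar from the first
  factor to the second one replaces \<open>f (r 1)\<close> by \<open>h (r 1)\<close>.
\<close>

lemma ev_K:
  assumes "z \<in> K" shows "ev z = \<zero>\<^bsub>C\<^esub>"
proof -
  have scal: "f (r \<odot>\<^bsub>A\<^esub> a) \<otimes>\<^bsub>C\<^esub> h b = f a \<otimes>\<^bsub>C\<^esub> h (r \<odot>\<^bsub>B\<^esub> b)"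
    if r: "r \<in> carrier R" "a \<in> carrier A" "b \<in> carrier B" for r a b
  proof -
    have "f (r \<odot>\<^bsub>A\<^esub> a) = f (r \<odot>\<^bsub>A\<^esub> \<one>\<^bsub>A\<^esub>) \<otimes>\<^bsub>C\<^esub> f a"
      using r f_simps(2)[of "r \<odot>\<^bsub>A\<^esub> \<one>\<^bsub>A\<^esub>" a] A.smult_assoc2[of r "\<one>\<^bsub>A\<^esub>" a] by simp
    moreover have "h (r \<odot>\<^bsub>B\<^esub> b) = h (r \<odot>\<^bsub>B\<^esub> \<one>\<^bsub>B\<^esub>) \<otimes>\<^bsub>C\<^esub> h b"
      using r h_simps(2)[of "r \<odot>\<^bsub>B\<^esub> \<one>\<^bsub>B\<^esub>" b] B.smult_assoc2[of r "\<one>\<^bsub>B\<^esub>" b] by simp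
    ultimately show ?thesis using r by (simp add: fh f_simps h_simps C.m_ac)
  qed
  have rel: "ev x = \<zero>\<^bsub>C\<^esub>" if "x \<in> tensor_rels R A B" for x
    using that
  proof (cases rule: tensor_rels_cases)
    case (left m m' n)
    have d: "frag_of (m \<oplus>\<^bsub>A\<^esub> m', n) - frag_of (m, n) \<in> carrier Pr"
      using left Pr.minus_closed[of "frag_of (m \<oplus>\<^bsub>A\<^esub> m', n)" "frag_of (m, n)"]
      by (simp add: Pr_minus frag_of_Pr)
    show ?thesis unfolding left(4) using left(1-3) d
      by (simp add: ev_diff frag_of_Pr ev_of f_simps h_simps C.l_distr a_minus_def C.a_ac C.r_neg1 C.r_neg)
  next
    case (right m n n')
    have d: "frag_of (m, n \<oplus>\<^bsub>B\<^esub> n') - frag_of (m, n) \<in> carrier Pr"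
      using right Pr.minus_closed[of "frag_of (m, n \<oplus>\<^bsub>B\<^esub> n')" "frag_of (m, n)"]
      by (simp add: Pr_minus frag_of_Pr)
    show ?thesis unfolding right(4) using right(1-3) d
      by (simp add: ev_diff frag_of_Pr ev_of f_simps h_simps C.r_distr a_minus_def C.a_ac C.r_neg1 C.r_neg)
  next
    case (scalar r m n)
    then show ?thesis
      by (simp add: ev_diff frag_of_Pr ev_of f_simps h_simps scal C.r_right_minus_eq)
  qed
  have Kc: "K \<subseteq> carrier Pr" by (rule KI.a_subset)
  show ?thesis
    using assms
  proof (induction rule: K_induct)
    case (uminus x)
    have "ev (0 - x) = \<zero>\<^bsub>C\<^esub>"
      using uminus rel[of x] Kc rels_in_K[of x] K_closed(1)
      by (subst ev_diff) (auto simp: ev_0)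
    then show ?case by simp
  next
    case (add x y)
    then show ?case using Kc by (auto simp: ev_add)
  qed (auto simp: ev_0 rel)
qed

lemma tensor_lift_coset:
  assumes z: "z \<in> carrier Pr"
  shows "tensor_lift C f h (K +>\<^bsub>Pr\<^esub> z) = ev z"
proof -
  have "ev y = ev z" if y: "y \<in> K +>\<^bsub>Pr\<^esub> z" for y
  proof -
    obtain k where k: "k \<in> K" "y = k + z"
      using y unfolding a_r_coset_def' pair_ring_simps(3) by blast
    have "k \<in> carrier Pr" using k(1) KI.a_subset by blast
    then have "ev y = ev k \<oplus>\<^bsub>C\<^esub> ev z" unfolding k(2) using z by (rule ev_add)
    then show ?thesis by (simp add: ev_K k(1) ev_closed z)
  qed
  moreover have "z \<in> K +>\<^bsub>Pr\<^esub> z" using KI.a_rcos_self[OF z] .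
  ultimately have "ev ` (K +>\<^bsub>Pr\<^esub> z) = {ev z}" by blast
  moreover have "tensor_lift C f h Y = the_elem (ev ` Y)" for Y
    unfolding tensor_lift_def pair_eval_def[abs_def] ..
  ultimately show ?thesis by simp
qed

lemma tensor_lift_pure:
  "a \<in> carrier A \<Longrightarrow> b \<in> carrier B \<Longrightarrow>
    tensor_lift C f h (pure_tensor R A B a b) = f a \<otimes>\<^bsub>C\<^esub> h b"
  by (simp add: pure_tensor_def tensor_lift_coset frag_of_Pr ev_of)

lemma tensor_lift_hom: "tensor_lift C f h \<in> ring_hom T C"
proof (rule ring_hom_memI)
  fix x assume "x \<in> carrier T"
  then obtain u where u: "u \<in> carrier Pr" "x = K +>\<^bsub>Pr\<^esub> u" by (auto simp: carrier_T)
  then show "tensor_lift C f h x \<in> carrier C" by (simp add: tensor_lift_coset ev_closed)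
  fix y assume "y \<in> carrier T"
  then obtain v where v: "v \<in> carrier Pr" "y = K +>\<^bsub>Pr\<^esub> v" by (auto simp: carrier_T)
  show "tensor_lift C f h (x \<otimes>\<^bsub>T\<^esub> y) = tensor_lift C f h x \<otimes>\<^bsub>C\<^esub> tensor_lift C f h y"
    using u v ring_hom_mult[OF coset_ring_hom u(1) v(1), symmetric]
    by (simp add: tensor_lift_coset ev_mult)
  show "tensor_lift C f h (x \<oplus>\<^bsub>T\<^esub> y) = tensor_lift C f h x \<oplus>\<^bsub>C\<^esub> tensor_lift C f h y"
    using u v ring_hom_add[OF coset_ring_hom u(1) v(1), symmetric] Pr.a_closed[OF u(1) v(1)]
    by (simp add: tensor_lift_coset ev_add pair_ring_simps(3))
next
  show "tensor_lift C f h \<one>\<^bsub>T\<^esub> = \<one>\<^bsub>C\<^esub>"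
    by (simp add: pure_tensor_one tensor_lift_pure f_simps h_simps)
qed

end

section \<open>The p-adic completion\<close>

lemma ring_hom_nat_multiple_one:
  assumes "ring A" "ring B" "f \<in> ring_hom A B"
  shows "f ([(k::nat)] \<cdot>\<^bsub>A\<^esub> \<one>\<^bsub>A\<^esub>) = [k] \<cdot>\<^bsub>B\<^esub> \<one>\<^bsub>B\<^esub>"
proof -
  interpret ring_hom_ring A B f by (rule ring_hom_ringI2[OF assms])
  show ?thesis by (induction k) simp_all
qed

locale adic = cring A for p :: nat and A :: "('a, 'm) ring_scheme" (structure)
begin

abbreviation "I n \<equiv> pow_ideal p A n"
abbreviation "Q n \<equiv> A Quot I n"
abbreviation "Ahat \<equiv> completion p A"
abbreviation "\<iota> \<equiv> to_completion p A"

definition ppow :: "nat \<Rightarrow> 'a" where "ppow n = [(p ^ n)] \<cdot> \<one>"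

lemma ppow_closed [simp]: "ppow n \<in> carrier A"
  by (simp add: ppow_def)

lemma ppow_mult: "ppow m \<otimes> ppow n = ppow (m + n)"
  by (simp add: ppow_def add_pow_ldistr add_pow_rdistr add.nat_pow_pow power_add mult.commute)

lemma I_eq: "I n = {x \<otimes> ppow n | x. x \<in> carrier A}"
  by (simp add: pow_ideal_def cgenideal_def ppow_def)

lemma I_ideal: "ideal (I n) A"
  unfolding pow_ideal_def by (rule cgenideal_ideal) simp

lemma Q_cring: "cring (Q n)"
  by (rule ideal.quotient_is_cring[OF I_ideal is_cring])

lemma Q_hom: "(+>) (I n) \<in> ring_hom A (Q n)"
  by (rule ideal.rcos_ring_hom[OF I_ideal])

lemma carrier_Q: "carrier (Q n) = (+>) (I n) ` carrier A"
  by (auto simp: FactRing_def A_RCOSETS_def')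

lemma Q_ops:
  assumes "a \<in> carrier A" "b \<in> carrier A"
  shows "(I n +> a) \<otimes>\<^bsub>Q n\<^esub> (I n +> b) = I n +> a \<otimes> b"
    and "(I n +> a) \<oplus>\<^bsub>Q n\<^esub> (I n +> b) = I n +> (a \<oplus> b)"
  using ring_hom_mult[OF Q_hom assms] ring_hom_add[OF Q_hom assms] by simp_all

lemma Q_one: "\<one>\<^bsub>Q n\<^esub> = I n +> \<one>" and Q_zero: "\<zero>\<^bsub>Q n\<^esub> = I n +> \<zero>"
  using ring_hom_one[OF Q_hom] ring_hom_zero[OF Q_hom ring_axioms cring.axioms(1)[OF Q_cring]]
  by simp_all

lemma coset_eq_iff:
  "a \<in> carrier A \<Longrightarrow> b \<in> carrier A \<Longrightarrow> I n +> a = I n +> b \<longleftrightarrow> a \<ominus> b \<in> I n"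
  using quotient_eq_iff_same_a_r_cos[OF I_ideal] by simp

lemma coset_self: "a \<in> carrier A \<Longrightarrow> a \<in> I n +> a"
proof -
  interpret ideal "I n" A by (rule I_ideal)
  show "a \<in> carrier A \<Longrightarrow> a \<in> I n +> a" by (rule a_rcos_self)
qed

lemma mem_coset:
  assumes "b \<in> I n +> a" "a \<in> carrier A" shows "b \<in> carrier A" "I n +> b = I n +> a"
proof -
  interpret ideal "I n" A by (rule I_ideal)
  show "b \<in> carrier A" using assms a_elemrcos_carrier by blast
  show "I n +> b = I n +> a" using assms a_repr_independence[OF assms(1,2) a_subgroup] by simp
qed

lemma I_Suc_subset: "I (Suc n) \<subseteq> I n"
proof
  fix y assume "y \<in> I (Suc n)"
  then obtain x where "x \<in> carrier A" "y = x \<otimes> ppow (Suc n)" unfolding I_eq by blast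
  then have "y = (x \<otimes> ppow 1) \<otimes> ppow n" "x \<otimes> ppow 1 \<in> carrier A" by (simp_all add: m_assoc ppow_mult)
  then show "y \<in> I n" unfolding I_eq by blast
qed

lemma coset_Suc_subset:
  assumes "a \<in> carrier A" "b \<in> carrier A"
  shows "I (Suc n) +> b \<subseteq> I n +> a \<longleftrightarrow> I n +> b = I n +> a"
proof
  assume "I (Suc n) +> b \<subseteq> I n +> a"
  then show "I n +> b = I n +> a"
    using coset_self[OF assms(2), of "Suc n"] mem_coset(2)[OF _ assms(1)] by blast
next
  assume "I n +> b = I n +> a"
  moreover have "I (Suc n) +> b \<subseteq> I n +> b"
    using I_Suc_subset unfolding a_r_coset_def' by blast
  ultimately show "I (Suc n) +> b \<subseteq> I n +> a" by simp
qed

text \<open>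
  Inclusion of cosets is compatibility of representatives: elements of the completion are the sequences
  of classes of \<open>a n\<close> with \<open>a (n + 1)\<close> congruent to \<open>a n\<close> modulo \<open>p ^ n\<close>.
\<close>

lemma mem_completion_iff:
  "s \<in> carrier Ahat \<longleftrightarrow> (\<exists>a. \<forall>n. a n \<in> carrier A \<and> s n = I n +> a n \<and> I n +> a (Suc n) = I n +> a n)"
    (is "?L \<longleftrightarrow> ?R")
proof
  assume ?L
  then have s: "\<And>n. s n \<in> (+>) (I n) ` carrier A" "\<And>n. s (Suc n) \<subseteq> s n"
    by (auto simp: completion_def Let_def carrier_Q)
  then have "\<forall>n. \<exists>a. a \<in> carrier A \<and> s n = I n +> a" by blast
  then obtain a where a: "\<And>n. a n \<in> carrier A" "\<And>n. s n = I n +> a n" by metis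
  have "I n +> a (Suc n) = I n +> a n" for n
    using s(2)[of n] coset_Suc_subset[of "a n" "a (Suc n)" n] by (simp add: a)
  with a show ?R by blast
next
  assume ?R
  then obtain a where a: "\<And>n. a n \<in> carrier A" "\<And>n. s n = I n +> a n"
      "\<And>n. I n +> a (Suc n) = I n +> a n" by blast
  have "s (Suc n) \<subseteq> s n" for n
    using coset_Suc_subset[OF a(1) a(1)] a(3)[of n] unfolding a(2) by blast
  then show ?L using a(1) by (simp add: completion_def Let_def carrier_Q a(2))
qed

lemma completion_ops:
  "(s \<otimes>\<^bsub>Ahat\<^esub> t) n = s n \<otimes>\<^bsub>Q n\<^esub> t n" "(s \<oplus>\<^bsub>Ahat\<^esub> t) n = s n \<oplus>\<^bsub>Q n\<^esub> t n"
  "\<one>\<^bsub>Ahat\<^esub> n = \<one>\<^bsub>Q n\<^esub>" "\<zero>\<^bsub>Ahat\<^esub> n = \<zero>\<^bsub>Q n\<^esub>"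
  by (simp_all add: completion_def Let_def)

lemma completion_component: "s \<in> carrier Ahat \<Longrightarrow> s n \<in> carrier (Q n)"
  by (simp add: completion_def Let_def)

lemma mem_completionI:
  assumes "\<And>n. a n \<in> carrier A" "\<And>n. s n = I n +> a n" "\<And>n. I n +> a (Suc n) = I n +> a n"
  shows "s \<in> carrier Ahat"
  unfolding mem_completion_iff using assms by blast

lemma completion_closed:
  assumes s: "s \<in> carrier Ahat" and t: "t \<in> carrier Ahat"
  shows "s \<otimes>\<^bsub>Ahat\<^esub> t \<in> carrier Ahat" "s \<oplus>\<^bsub>Ahat\<^esub> t \<in> carrier Ahat"
proof -
  obtain a where a: "\<And>n. a n \<in> carrier A" "\<And>n. s n = I n +> a n"
      "\<And>n. I n +> a (Suc n) = I n +> a n" using s unfolding mem_completion_iff by blast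
  obtain b where b: "\<And>n. b n \<in> carrier A" "\<And>n. t n = I n +> b n"
      "\<And>n. I n +> b (Suc n) = I n +> b n" using t unfolding mem_completion_iff by blast
  show "s \<otimes>\<^bsub>Ahat\<^esub> t \<in> carrier Ahat"
    by (rule mem_completionI[of "\<lambda>n. a n \<otimes> b n"])
       (simp add: a(1) b(1), simp add: a(1,2) b(1,2) completion_ops Q_ops,
        simp only: Q_ops[symmetric] a(1,3) b(1,3))
  show "s \<oplus>\<^bsub>Ahat\<^esub> t \<in> carrier Ahat"
    by (rule mem_completionI[of "\<lambda>n. a n \<oplus> b n"])
       (simp add: a(1) b(1), simp add: a(1,2) b(1,2) completion_ops Q_ops,
        simp only: Q_ops[symmetric] a(1,3) b(1,3))
qed

lemma const_in_completion: "a \<in> carrier A \<Longrightarrow> \<iota> a \<in> carrier Ahat"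
  by (rule mem_completionI[of "\<lambda>_. a"]) (simp_all add: to_completion_def)

lemma completion_cring: "cring Ahat"
proof -
  have c: "\<zero>\<^bsub>Ahat\<^esub> \<in> carrier Ahat" "\<one>\<^bsub>Ahat\<^esub> \<in> carrier Ahat"
    by (rule mem_completionI[of "\<lambda>_. \<zero>"]; simp add: completion_ops Q_zero)
       (rule mem_completionI[of "\<lambda>_. \<one>"]; simp add: completion_ops Q_one)
  interpret Q: cring "Q n" for n by (rule Q_cring)
  note comp = completion_component
  show ?thesis
  proof (rule cringI)
    show "abelian_group Ahat"
    proof (rule abelian_groupI)
      fix s assume "s \<in> carrier Ahat"
      then obtain a where a: "\<And>n. a n \<in> carrier A" "\<And>n. s n = I n +> a n"
        "\<And>n. I n +> a (Suc n) = I n +> a n" unfolding mem_completion_iff by blast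
      have e: "I n +> \<ominus> a (Suc n) = I n +> \<ominus> a n" for n
      proof -
        have "a n \<ominus> a (Suc n) \<in> I n" using a(3)[of n] a(1) coset_eq_iff by metis
        moreover have "\<ominus> a (Suc n) \<ominus> \<ominus> a n = a n \<ominus> a (Suc n)"
          using a(1)[of n] a(1)[of "Suc n"] by (simp add: a_minus_def a_comm)
        ultimately show ?thesis using coset_eq_iff[of "\<ominus> a (Suc n)" "\<ominus> a n" n] a(1) by simp
      qed
      show "\<exists>t\<in>carrier Ahat. t \<oplus>\<^bsub>Ahat\<^esub> s = \<zero>\<^bsub>Ahat\<^esub>"
      proof (rule bexI)
        show "(\<lambda>n. I n +> \<ominus> a n) \<in> carrier Ahat"
          by (rule mem_completionI[of "\<lambda>n. \<ominus> a n"]) (simp_all add: a(1) e)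
        show "(\<lambda>n. I n +> \<ominus> a n) \<oplus>\<^bsub>Ahat\<^esub> s = \<zero>\<^bsub>Ahat\<^esub>"
          by (rule ext) (simp add: completion_ops a(1,2) Q_ops Q_zero l_neg)
      qed
    qed (auto simp: c completion_closed completion_ops fun_eq_iff comp Q.a_ac)
    show "comm_monoid Ahat"
      by (rule comm_monoidI) (auto simp: c completion_closed completion_ops fun_eq_iff comp Q.m_ac)
  qed (auto simp: completion_ops fun_eq_iff comp Q.l_distr)
qed

lemma to_completion_hom: "\<iota> \<in> ring_hom A Ahat"
  by (rule ring_hom_memI)
     (simp_all add: const_in_completion, simp_all add: to_completion_def completion_ops fun_eq_iff Q_ops Q_one)

lemma component_hom: "(\<lambda>s. s n) \<in> ring_hom Ahat (Q n)"
  by (rule ring_hom_memI) (simp_all add: completion_ops completion_component)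

lemma Q_p_power: "[(p ^ n)] \<cdot>\<^bsub>Q n\<^esub> \<one>\<^bsub>Q n\<^esub> = \<zero>\<^bsub>Q n\<^esub>"
proof -
  have "[(p ^ n)] \<cdot>\<^bsub>Q n\<^esub> \<one>\<^bsub>Q n\<^esub> = I n +> ppow n"
    using ring_hom_nat_multiple_one[OF ring_axioms cring.axioms(1)[OF Q_cring] Q_hom] by (simp add: ppow_def)
  moreover have "\<one> \<otimes> ppow n \<in> I n" unfolding I_eq by blast
  ultimately show ?thesis using coset_eq_iff[of "ppow n" \<zero> n] by (simp add: Q_zero a_minus_def)
qed

text \<open>
  If the classes of \<open>a k\<close> represent \<open>s\<close>, then \<open>a (k + 1) = a k + p ^ k e k\<close> for suitable \<open>e k\<close>, and
  \<open>a n = p ^ n t0\<close>. Hence \<open>a (n + k) = p ^ n t k\<close> with \<open>t k = t0 + (\<Sum>j<k. p ^ j e (n + j))\<close>, and the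
  sequence \<open>t\<close> is compatible.
\<close>

lemma component_kernel:
  assumes s: "s \<in> carrier Ahat" and z: "s n = \<zero>\<^bsub>Q n\<^esub>"
  shows "\<exists>t\<in>carrier Ahat. s = \<iota> (ppow n) \<otimes>\<^bsub>Ahat\<^esub> t"
proof -
  obtain a where a: "\<And>n. a n \<in> carrier A" "\<And>n. s n = I n +> a n"
    "\<And>n. I n +> a (Suc n) = I n +> a n" using s unfolding mem_completion_iff by blast
  have "a n \<in> I n"
    using coset_eq_iff[OF a(1) zero_closed, of n n] z a(1)[of n] by (simp add: a(2) Q_zero a_minus_def)
  then obtain t0 where t0: "t0 \<in> carrier A" "a n = t0 \<otimes> ppow n" unfolding I_eq by blast
  have "\<exists>e. e \<in> carrier A \<and> a (Suc m) = a m \<oplus> ppow m \<otimes> e" for m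
  proof -
    have "a (Suc m) \<ominus> a m \<in> I m" using a(3)[of m] a(1) coset_eq_iff by metis
    then obtain e where e: "e \<in> carrier A" "a (Suc m) \<ominus> a m = e \<otimes> ppow m" unfolding I_eq by blast
    have "a (Suc m) = a m \<oplus> (a (Suc m) \<ominus> a m)"
      using a(1)[of m] a(1)[of "Suc m"] by algebra
    with e have "a (Suc m) = a m \<oplus> ppow m \<otimes> e" by (simp add: m_comm)
    with e(1) show ?thesis by blast
  qed
  then obtain e where e: "\<And>m. e m \<in> carrier A" "\<And>m. a (Suc m) = a m \<oplus> ppow m \<otimes> e m" by metis
  define t where "t = rec_nat t0 (\<lambda>k x. x \<oplus> ppow k \<otimes> e (n + k))"
  have t_Suc: "t (Suc k) = t k \<oplus> ppow k \<otimes> e (n + k)" for k by (simp add: t_def)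
  have t: "t k \<in> carrier A" for k
    by (induction k) (simp_all add: t_def t0 e)
  have at: "a (n + k) = ppow n \<otimes> t k" for k
  proof (induction k)
    case 0
    show ?case using t0 by (simp add: t_def m_comm)
  next
    case (Suc k)
    have "a (n + Suc k) = ppow n \<otimes> t k \<oplus> ppow (n + k) \<otimes> e (n + k)" using e(2)[of "n + k"] Suc by simp
    also have "\<dots> = ppow n \<otimes> t (Suc k)"
      using t e(1) by (simp add: t_Suc r_distr ppow_mult[symmetric] m_assoc)
    finally show ?case .
  qed
  (* The class of s modulo p ^ k may be read off at any later index, in particular at n + k. *)
  have shift: "I k +> a (k + m) = I k +> a k" for k m
  proof (induction m)
    case (Suc m)
    have "I k +> a (Suc (k + m)) = I k +> a (k + m)"
    proof (rule mem_coset(2)[OF _ a(1)])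
      have sub: "I (k + m) \<subseteq> I k" by (induction m) (use I_Suc_subset in auto)
      have "a (Suc (k + m)) \<in> I (k + m) +> a (k + m)"
        using coset_self[OF a(1), of "Suc (k + m)" "k + m"] a(3)[of "k + m"] by simp
      then show "a (Suc (k + m)) \<in> I k +> a (k + m)" using sub unfolding a_r_coset_def' by blast
    qed
    then show ?case using Suc by simp
  qed simp
  have tcong: "I k +> t (Suc k) = I k +> t k" for k
  proof -
    have "t (Suc k) \<ominus> t k = e (n + k) \<otimes> ppow k"
      unfolding t_Suc using t[of k] e(1)[of "n + k"] ppow_closed[of k] by algebra
    then have "t (Suc k) \<ominus> t k \<in> I k" unfolding I_eq using e(1)[of "n + k"] by blast
    then show ?thesis using coset_eq_iff t by blast
  qed
  show ?thesis
  proof (rule bexI)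
    show "(\<lambda>k. I k +> t k) \<in> carrier Ahat" by (rule mem_completionI[of t]) (simp_all add: t tcong)
    show "s = \<iota> (ppow n) \<otimes>\<^bsub>Ahat\<^esub> (\<lambda>k. I k +> t k)"
    proof
      fix k
      have "s k = I k +> a (n + k)" using shift[of k n] by (simp add: a(2) add.commute)
      then show "s k = (\<iota> (ppow n) \<otimes>\<^bsub>Ahat\<^esub> (\<lambda>k. I k +> t k)) k"
        by (simp add: at completion_ops to_completion_def Q_ops t)
    qed
  qed
qed

end

lemma completion_map_const:
  fixes A :: "('a, 'm) ring_scheme" and B :: "('b, 'n) ring_scheme"
  assumes A: "cring A" and B: "cring B" and f: "f \<in> ring_hom A B" and a: "a \<in> carrier A"
  shows "completion_map p B f (to_completion p A a) = to_completion p B (f a)"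
proof
  interpret A: adic p A by (rule adic.intro) (rule A)
  interpret B: adic p B by (rule adic.intro) (rule B)
  interpret f: ring_hom_ring A B f by (rule ring_hom_ringI2[OF A.ring_axioms B.ring_axioms f])
  fix n
  have ppow: "f (A.ppow n) = B.ppow n"
    unfolding A.ppow_def B.ppow_def by (rule ring_hom_nat_multiple_one[OF A.ring_axioms B.ring_axioms f])
  have "B.I n +>\<^bsub>B\<^esub> f b = B.I n +>\<^bsub>B\<^esub> f a" if b: "b \<in> A.I n +>\<^bsub>A\<^esub> a" for b
  proof -
    have bA: "b \<in> carrier A" "b \<ominus>\<^bsub>A\<^esub> a \<in> A.I n"
      using A.mem_coset[OF b a] A.coset_eq_iff[of b a n] a by auto
    then obtain x where x: "x \<in> carrier A" "b \<ominus>\<^bsub>A\<^esub> a = x \<otimes>\<^bsub>A\<^esub> A.ppow n" unfolding A.I_eq by blast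
    have "f b \<ominus>\<^bsub>B\<^esub> f a = f (b \<ominus>\<^bsub>A\<^esub> a)" using a bA(1) by (simp add: a_minus_def)
    then have "f b \<ominus>\<^bsub>B\<^esub> f a = f x \<otimes>\<^bsub>B\<^esub> B.ppow n" using x by (simp add: ppow)
    then have "f b \<ominus>\<^bsub>B\<^esub> f a \<in> B.I n" unfolding B.I_eq using f.hom_closed[OF x(1)] by blast
    then show ?thesis using B.coset_eq_iff[of "f b" "f a" n] a bA(1) by simp
  qed
  then show "completion_map p B f (to_completion p A a) n = to_completion p B (f a) n"
    using A.coset_self[OF a, of n] unfolding completion_map_def to_completion_def by blast
qed

text \<open>
  Continuity comes for free: modulo \<open>p ^ n\<close> every \<open>s\<close> is a constant plus a multiple of \<open>p ^ n\<close>, and ring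
  homomorphisms preserve multiples of \<open>p ^ n\<close>.
\<close>

lemma (in adic) ring_hom_eq_of_eq_on_constants:
  assumes F: "F \<in> ring_hom Ahat Ahat" and F': "F' \<in> ring_hom Ahat Ahat"
    and eq: "\<And>a. a \<in> carrier A \<Longrightarrow> F (\<iota> a) = F' (\<iota> a)" and s: "s \<in> carrier Ahat"
  shows "F s = F' s"
proof
  fix n
  interpret H: cring Ahat by (rule completion_cring)
  interpret Q: cring "Q n" by (rule Q_cring)
  obtain a where a: "a \<in> carrier A" "s n = I n +> a"
    using s unfolding mem_completion_iff by blast
  have \<iota>a: "\<iota> a \<in> carrier Ahat" by (rule const_in_completion[OF a(1)])
  have "(s \<ominus>\<^bsub>Ahat\<^esub> \<iota> a) n = \<zero>\<^bsub>Q n\<^esub>"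
  proof -
    interpret c: ring_hom_ring Ahat "Q n" "\<lambda>s. s n"
      by (rule ring_hom_ringI2[OF H.ring_axioms Q.ring_axioms component_hom])
    have "(s \<ominus>\<^bsub>Ahat\<^esub> \<iota> a) n = s n \<ominus>\<^bsub>Q n\<^esub> \<iota> a n"
      using s \<iota>a by (simp add: a_minus_def completion_ops c.hom_a_inv)
    also have "\<dots> = \<zero>\<^bsub>Q n\<^esub>"
      using completion_component[OF \<iota>a, of n] a(2) by (simp add: to_completion_def Q.r_right_minus_eq)
    finally show ?thesis .
  qed
  then obtain t where t: "t \<in> carrier Ahat" "s \<ominus>\<^bsub>Ahat\<^esub> \<iota> a = \<iota> (ppow n) \<otimes>\<^bsub>Ahat\<^esub> t"
    using component_kernel[of "s \<ominus>\<^bsub>Ahat\<^esub> \<iota> a" n] s \<iota>a by auto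
  have pn: "\<iota> (ppow n) = [(p ^ n)] \<cdot>\<^bsub>Ahat\<^esub> \<one>\<^bsub>Ahat\<^esub>"
    unfolding ppow_def
    by (rule ring_hom_nat_multiple_one[OF ring_axioms H.ring_axioms to_completion_hom])
  have "s = \<iota> a \<oplus>\<^bsub>Ahat\<^esub> (s \<ominus>\<^bsub>Ahat\<^esub> \<iota> a)" using s \<iota>a by algebra
  then have s_eq: "s = \<iota> a \<oplus>\<^bsub>Ahat\<^esub> [(p ^ n)] \<cdot>\<^bsub>Ahat\<^esub> \<one>\<^bsub>Ahat\<^esub> \<otimes>\<^bsub>Ahat\<^esub> t" by (simp add: t(2) pn)
  have "E s n = E (\<iota> a) n" if E: "E \<in> ring_hom Ahat Ahat" for E
  proof -
    have "(E ([(p ^ n)] \<cdot>\<^bsub>Ahat\<^esub> \<one>\<^bsub>Ahat\<^esub>)) n = \<zero>\<^bsub>Q n\<^esub>"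
      using ring_hom_nat_multiple_one[OF H.ring_axioms H.ring_axioms E]
        ring_hom_nat_multiple_one[OF H.ring_axioms Q.ring_axioms component_hom[of n]] Q_p_power by simp
    moreover have "E s = E (\<iota> a) \<oplus>\<^bsub>Ahat\<^esub> E ([(p ^ n)] \<cdot>\<^bsub>Ahat\<^esub> \<one>\<^bsub>Ahat\<^esub>) \<otimes>\<^bsub>Ahat\<^esub> E t"
      using \<iota>a t(1) by (subst s_eq) (simp add: ring_hom_add[OF E] ring_hom_mult[OF E])
    ultimately show ?thesis
      using completion_component[OF ring_hom_closed[OF E \<iota>a]] completion_component[OF ring_hom_closed[OF E t(1)]]
      by (simp add: completion_ops)
  qed
  from this[OF F] this[OF F'] show "F s n = F' s n" using eq[OF a(1)] by simp
qed

text \<open>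
  Both values are congruent to \<open>b ^ p\<close>.
\<close>

lemma lifts_frobenius_congruent:
  assumes B: "cring B" and D: "cring D" and e: "e \<in> ring_hom B D"
    and F: "lifts_frobenius p B F" and F': "lifts_frobenius p B F'" and b: "b \<in> carrier B"
  shows "\<exists>y\<in>carrier D. e (F b) = e (F' b) \<oplus>\<^bsub>D\<^esub> [p] \<cdot>\<^bsub>D\<^esub> y"
proof -
  interpret B: cring B by (rule B)
  interpret D: cring D by (rule D)
  have mod: "\<exists>x\<in>carrier D. e (E b) = e (b [^]\<^bsub>B\<^esub> p) \<oplus>\<^bsub>D\<^esub> [p] \<cdot>\<^bsub>D\<^esub> x" if E: "lifts_frobenius p B E" for E
  proof -
    have Eb: "E b \<in> carrier B" using E b by (auto simp: lifts_frobenius_def ring_hom_closed)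
    obtain x where x: "x \<in> carrier B" "E b \<ominus>\<^bsub>B\<^esub> b [^]\<^bsub>B\<^esub> p = x \<otimes>\<^bsub>B\<^esub> [p] \<cdot>\<^bsub>B\<^esub> \<one>\<^bsub>B\<^esub>"
      using E b unfolding lifts_frobenius_def cgenideal_def by blast
    have bp: "b [^]\<^bsub>B\<^esub> p \<in> carrier B" using b by simp
    have "E b = b [^]\<^bsub>B\<^esub> p \<oplus>\<^bsub>B\<^esub> (E b \<ominus>\<^bsub>B\<^esub> b [^]\<^bsub>B\<^esub> p)" using Eb bp by algebra
    then have "e (E b) = e (b [^]\<^bsub>B\<^esub> p \<oplus>\<^bsub>B\<^esub> x \<otimes>\<^bsub>B\<^esub> [p] \<cdot>\<^bsub>B\<^esub> \<one>\<^bsub>B\<^esub>)" by (simp add: x(2))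
    also have "\<dots> = e (b [^]\<^bsub>B\<^esub> p) \<oplus>\<^bsub>D\<^esub> e x \<otimes>\<^bsub>D\<^esub> [p] \<cdot>\<^bsub>D\<^esub> \<one>\<^bsub>D\<^esub>"
      using x(1) bp
      by (simp add: ring_hom_add[OF e] ring_hom_mult[OF e]
          ring_hom_nat_multiple_one[OF B.ring_axioms D.ring_axioms e] del: B.add_pow_rdistr)
    also have "e x \<otimes>\<^bsub>D\<^esub> [p] \<cdot>\<^bsub>D\<^esub> \<one>\<^bsub>D\<^esub> = [p] \<cdot>\<^bsub>D\<^esub> e x"
      using ring_hom_closed[OF e x(1)] by (simp add: D.add_pow_rdistr)
    finally show ?thesis using ring_hom_closed[OF e x(1)] by blast
  qed
  obtain x y where xy: "x \<in> carrier D" "e (F b) = e (b [^]\<^bsub>B\<^esub> p) \<oplus>\<^bsub>D\<^esub> [p] \<cdot>\<^bsub>D\<^esub> x"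
    "y \<in> carrier D" "e (F' b) = e (b [^]\<^bsub>B\<^esub> p) \<oplus>\<^bsub>D\<^esub> [p] \<cdot>\<^bsub>D\<^esub> y"
    using mod[OF F] mod[OF F'] by blast
  have w: "e (b [^]\<^bsub>B\<^esub> p) \<in> carrier D" using ring_hom_closed[OF e] b by simp
  have diff: "[p] \<cdot>\<^bsub>D\<^esub> (x \<ominus>\<^bsub>D\<^esub> y) = [p] \<cdot>\<^bsub>D\<^esub> x \<ominus>\<^bsub>D\<^esub> [p] \<cdot>\<^bsub>D\<^esub> y"
    using xy(1,3) by (simp add: a_minus_def D.add.nat_pow_distrib D.add.nat_pow_inv)
  have cancel: "w \<oplus>\<^bsub>D\<^esub> x' = (w \<oplus>\<^bsub>D\<^esub> y') \<oplus>\<^bsub>D\<^esub> (x' \<ominus>\<^bsub>D\<^esub> y')"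
    if "w \<in> carrier D" "x' \<in> carrier D" "y' \<in> carrier D" for w x' y'
    using that by algebra
  have "e (F b) = e (F' b) \<oplus>\<^bsub>D\<^esub> [p] \<cdot>\<^bsub>D\<^esub> (x \<ominus>\<^bsub>D\<^esub> y)"
    unfolding xy(2,4) diff by (rule cancel) (use w xy(1,3) in simp_all)
  then show ?thesis using xy(1,3) by blast
qed

section \<open>Points of linear group schemes as matrices\<close>

lemma ring_hom_finsum:
  assumes A: "cring A" and D: "cring D" and f: "f \<in> ring_hom A D"
    and a: "\<And>k. k \<in> K \<Longrightarrow> a k \<in> carrier A"
    and b: "\<And>k. k \<in> K \<Longrightarrow> f (a k) = b k"
  shows "f (\<Oplus>\<^bsub>A\<^esub>k \<in> K. a k) = (\<Oplus>\<^bsub>D\<^esub>k \<in> K. b k)"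
proof -
  interpret f: ring_hom_cring A D f
    by (intro ring_hom_cringI ring_hom_ringI2 cring.axioms(1) A D f)
  have "f (\<Oplus>\<^bsub>A\<^esub>k \<in> K. a k) = (\<Oplus>\<^bsub>D\<^esub>k \<in> K. (f \<circ> a) k)"
    using f.hom_finsum[of a K] a by (auto simp: comp_def)
  also have "\<dots> = (\<Oplus>\<^bsub>D\<^esub>k \<in> K. b k)"
    by (rule f.S.finsum_cong') (use a b f.hom_closed in \<open>auto simp flip: b\<close>)
  finally show ?thesis .
qed

locale group_scheme =
  fixes R :: "('r, 'k) ring_scheme" and G :: "('r, 'a, 'm) hopf_scheme"
  assumes scheme: "affine_group_scheme R G"
begin

lemma algebra_G: "algebra R G"
  using scheme by (simp add: affine_group_scheme_def Let_def)

sublocale two_algebras R G G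
  by (rule two_algebras.intro) (rule algebra_G)+

lemma G_cring: "cring G"
  by (rule A.M_cring)

lemma comult_hom: "comult G \<in> ring_hom G T"
  and comult_scalar: "r \<in> carrier R \<Longrightarrow> a \<in> carrier G \<Longrightarrow> comult G (r \<odot>\<^bsub>G\<^esub> a) = r \<odot>\<^bsub>T\<^esub> comult G a"
  using scheme by (auto simp: affine_group_scheme_def Let_def alg_hom_def)

text \<open>
  A \<open>C\<close>-valued point of \<open>G\<close>, with \<open>C\<close> viewed as an \<open>R\<close>-algebra through \<open>\<sigma>\<close>. Keeping \<open>\<sigma>\<close> explicit
  allows the points over \<open>\<phi>\<close> which come from lifts of Frobenius; two points can be multiplied
  exactly when they lie over the same \<open>\<sigma>\<close>.
\<close>

definition point_over :: "('c, 'l) ring_scheme \<Rightarrow> ('r \<Rightarrow> 'c) \<Rightarrow> ('a \<Rightarrow> 'c) \<Rightarrow> bool"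
  where "point_over C \<sigma> f \<longleftrightarrow> f \<in> ring_hom G C \<and> (\<forall>r\<in>carrier R. f (r \<odot>\<^bsub>G\<^esub> \<one>\<^bsub>G\<^esub>) = \<sigma> r)"

lemma point_over_hom: "point_over C \<sigma> f \<Longrightarrow> f \<in> ring_hom G C"
  and point_over_scalar: "point_over C \<sigma> f \<Longrightarrow> r \<in> carrier R \<Longrightarrow> f (r \<odot>\<^bsub>G\<^esub> \<one>\<^bsub>G\<^esub>) = \<sigma> r"
  by (simp_all add: point_over_def)

lemma tensor_target_points:
  assumes "cring C" "point_over C \<sigma> f" "point_over C \<sigma> h"
  shows "tensor_target R G G C f h"
  using assms two_algebras_axioms
  by (simp add: tensor_target_def tensor_target_axioms_def point_over_def)

lemma point_over_point_mult:
  assumes C: "cring C" and pf: "point_over C \<sigma> f" and ph: "point_over C \<sigma> h"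
  shows "point_over C \<sigma> (point_mult G C f h)"
proof -
  interpret tensor_target R G G C f h by (rule tensor_target_points[OF assms])
  have "point_mult G C f h (r \<odot>\<^bsub>G\<^esub> \<one>\<^bsub>G\<^esub>) = \<sigma> r" if r: "r \<in> carrier R" for r
  proof -
    have "comult G (r \<odot>\<^bsub>G\<^esub> \<one>\<^bsub>G\<^esub>) = pure_tensor R G G (r \<odot>\<^bsub>G\<^esub> \<one>\<^bsub>G\<^esub>) \<one>\<^bsub>G\<^esub>"
      using r by (simp add: comult_scalar ring_hom_one[OF comult_hom] tensor_smult_one tensor_inl_def)
    then show ?thesis
      using r point_over_scalar[OF pf r] f_simps(1)[of "r \<odot>\<^bsub>G\<^esub> \<one>\<^bsub>G\<^esub>"]
      by (simp add: point_mult_def tensor_lift_pure h_simps)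
  qed
  then show ?thesis
    unfolding point_over_def point_mult_def using ring_hom_trans[OF comult_hom tensor_lift_hom] by simp
qed

lemma point_over_comp_alg_hom:
  assumes "point_over C \<sigma> f" "\<tau> \<in> alg_hom R G G"
  shows "point_over C \<sigma> (f \<circ> \<tau>)"
  using assms ring_hom_trans[of \<tau> G G f C] ring_hom_one[of \<tau> G G]
  by (auto simp: point_over_def alg_hom_def)

lemma point_over_comp_ring_hom:
  assumes "point_over C \<sigma> f" "e \<in> ring_hom C D"
  shows "point_over D (e \<circ> \<sigma>) (e \<circ> f)"
  using assms ring_hom_trans[of f G C e D] by (auto simp: point_over_def)

lemma point_over_id: "point_over G (\<lambda>r. r \<odot>\<^bsub>G\<^esub> \<one>\<^bsub>G\<^esub>) id"
  by (simp add: point_over_def id_ring_hom)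

lemma antipode_hom: "antipode G \<in> alg_hom R G G"
  using scheme by (simp add: affine_group_scheme_def Let_def)

lemma point_over_const_point:
  assumes g: "g \<in> alg_hom R G (alg_via id R)"
  shows "point_over G (\<lambda>r. r \<odot>\<^bsub>G\<^esub> \<one>\<^bsub>G\<^esub>) (const_point G g)"
proof -
  interpret G: cring G by (rule G_cring)
  have g_hom: "g \<in> ring_hom G R"
    and g_lin: "\<And>r a. r \<in> carrier R \<Longrightarrow> a \<in> carrier G \<Longrightarrow> g (r \<odot>\<^bsub>G\<^esub> a) = r \<otimes>\<^bsub>R\<^esub> g a"
    using g by (auto simp: alg_hom_def alg_via_def ring_hom_def)
  note g_simps = ring_hom_closed[OF g_hom] ring_hom_mult[OF g_hom] ring_hom_add[OF g_hom]
    ring_hom_one[OF g_hom]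
  have "const_point G g \<in> ring_hom G G"
  proof (rule ring_hom_memI)
    fix a b assume ab: "a \<in> carrier G" "b \<in> carrier G"
    show "const_point G g a \<in> carrier G" using ab by (simp add: const_point_def g_simps)
    show "const_point G g (a \<otimes>\<^bsub>G\<^esub> b) = const_point G g a \<otimes>\<^bsub>G\<^esub> const_point G g b"
      using ab by (simp add: const_point_def g_simps A.smult_assoc1 A.smult_assoc2)
    show "const_point G g (a \<oplus>\<^bsub>G\<^esub> b) = const_point G g a \<oplus>\<^bsub>G\<^esub> const_point G g b"
      using ab by (simp add: const_point_def g_simps A.smult_l_distr)
  qed (simp add: const_point_def g_simps)
  moreover have "const_point G g (r \<odot>\<^bsub>G\<^esub> \<one>\<^bsub>G\<^esub>) = r \<odot>\<^bsub>G\<^esub> \<one>\<^bsub>G\<^esub>" if "r \<in> carrier R" for r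
    using that by (simp add: const_point_def g_lin g_simps)
  ultimately show ?thesis by (simp add: point_over_def)
qed

lemma point_over_inl: "point_over T (\<lambda>r. tensor_inl R G G (r \<odot>\<^bsub>G\<^esub> \<one>\<^bsub>G\<^esub>)) (tensor_inl R G G)"
  and point_over_inr: "point_over T (\<lambda>r. tensor_inl R G G (r \<odot>\<^bsub>G\<^esub> \<one>\<^bsub>G\<^esub>)) (tensor_inr R G G)"
  by (simp_all add: point_over_def tensor_inl_hom tensor_inr_hom tensor_inl_inr_scalar)

text \<open>
  Scalars act on the tensor product through its first factor, so the constant point over the tensor
  product is the image of the one over \<open>G\<close>.
\<close>

lemma const_point_tensor:
  assumes g: "g \<in> alg_hom R G (alg_via id R)" and a: "a \<in> carrier G"
  shows "const_point T g a = tensor_inl R G G (const_point G g a)"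
proof -
  have "g a \<in> carrier R" using assms by (auto simp: alg_hom_def alg_via_def ring_hom_def)
  then show ?thesis by (simp add: const_point_def tensor_smult_one)
qed

lemma point_over_const_point_tensor:
  assumes g: "g \<in> alg_hom R G (alg_via id R)"
  shows "point_over T (\<lambda>r. tensor_inl R G G (r \<odot>\<^bsub>G\<^esub> \<one>\<^bsub>G\<^esub>)) (const_point T g)"
proof -
  have p: "point_over T (tensor_inl R G G \<circ> (\<lambda>r. r \<odot>\<^bsub>G\<^esub> \<one>\<^bsub>G\<^esub>)) (tensor_inl R G G \<circ> const_point G g)"
    by (rule point_over_comp_ring_hom[OF point_over_const_point[OF g] tensor_inl_hom])
  have "const_point T g \<in> ring_hom G T"
    by (rule ring.ring_hom_restrict[OF cring.axioms(1)[OF G_cring] point_over_hom[OF p]])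
       (simp add: const_point_tensor[OF g])
  with p show ?thesis using const_point_tensor[OF g] by (simp add: point_over_def)
qed

lemma point_over_twisted_point:
  assumes C: "cring C" and c: "point_over C \<sigma> (const_point C g)" and \<tau>: "\<tau> \<in> alg_hom R G G"
    and x: "point_over C \<sigma> x" and y: "point_over C \<sigma> y"
  shows "point_over C \<sigma> (twisted_point G g \<tau> C x y)"
  unfolding twisted_point_def
  by (intro point_over_point_mult point_over_comp_alg_hom C c x y \<tau> antipode_hom)

end

text \<open>
  A fixed closed embedding into \<open>GL_n\<close>: the matrix \<open>U\<close> of coordinate functions and its inverse \<open>V\<close>.
\<close>

locale linear_group = group_scheme R G
  for R :: "('r, 'k) ring_scheme" and G :: "('r, 'a, 'm) hopf_scheme" +
  fixes n :: nat and U V :: "nat \<Rightarrow> nat \<Rightarrow> 'a"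
  assumes U: "\<And>i j. i < n \<Longrightarrow> j < n \<Longrightarrow> U i j \<in> carrier G"
    and V: "\<And>i j. i < n \<Longrightarrow> j < n \<Longrightarrow> V i j \<in> carrier G"
    and UV: "\<And>i j. i < n \<Longrightarrow> j < n \<Longrightarrow>
      (\<Oplus>\<^bsub>G\<^esub>k \<in> {..<n}. U i k \<otimes>\<^bsub>G\<^esub> V k j) = (if i = j then \<one>\<^bsub>G\<^esub> else \<zero>\<^bsub>G\<^esub>)"
    and VU: "\<And>i j. i < n \<Longrightarrow> j < n \<Longrightarrow>
      (\<Oplus>\<^bsub>G\<^esub>k \<in> {..<n}. V i k \<otimes>\<^bsub>G\<^esub> U k j) = (if i = j then \<one>\<^bsub>G\<^esub> else \<zero>\<^bsub>G\<^esub>)"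
    and comult_U: "\<And>i j. i < n \<Longrightarrow> j < n \<Longrightarrow>
      comult G (U i j) = (\<Oplus>\<^bsub>tensor R G G\<^esub>k \<in> {..<n}. pure_tensor R G G (U i k) (U k j))"
    and generate: "generate_ring G ((\<lambda>r. r \<odot>\<^bsub>G\<^esub> \<one>\<^bsub>G\<^esub>) ` carrier R \<union>
      {U i j | i j. i < n \<and> j < n} \<union> {V i j | i j. i < n \<and> j < n}) = carrier G"
begin

abbreviation "Mat \<equiv> matrix_ring {..<n}"

definition point_matrix :: "('a \<Rightarrow> 'c) \<Rightarrow> nat \<times> nat \<Rightarrow> 'c"
  where "point_matrix f = (\<lambda>(i, j) \<in> {..<n} \<times> {..<n}. f (U i j))"

definition inverse_matrix :: "('a \<Rightarrow> 'c) \<Rightarrow> nat \<times> nat \<Rightarrow> 'c"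
  where "inverse_matrix f = (\<lambda>(i, j) \<in> {..<n} \<times> {..<n}. f (V i j))"

lemma point_matrix_cong:
  "(\<And>a. a \<in> carrier G \<Longrightarrow> f a = h a) \<Longrightarrow> point_matrix f = point_matrix h"
  by (auto simp: point_matrix_def U fun_eq_iff restrict_def)

lemma point_matrix_closed:
  "f \<in> ring_hom G D \<Longrightarrow> point_matrix f \<in> carrier (Mat D)"
  by (auto simp: point_matrix_def matrix_ring_def U ring_hom_closed)

lemma point_matrix_inverse:
  assumes D: "cring D" and f: "f \<in> ring_hom G D"
  shows "inverse_matrix f \<in> carrier (Mat D)"
    and "point_matrix f \<otimes>\<^bsub>Mat D\<^esub> inverse_matrix f = \<one>\<^bsub>Mat D\<^esub>"
    and "inverse_matrix f \<otimes>\<^bsub>Mat D\<^esub> point_matrix f = \<one>\<^bsub>Mat D\<^esub>"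
proof -
  interpret D: cring D by (rule D)
  note f_simps = ring_hom_closed[OF f] ring_hom_mult[OF f]
  have f01: "f \<one>\<^bsub>G\<^esub> = \<one>\<^bsub>D\<^esub>" "f \<zero>\<^bsub>G\<^esub> = \<zero>\<^bsub>D\<^esub>"
    by (rule ring_hom_one[OF f], rule ring_hom_zero[OF f cring.axioms(1)[OF G_cring] cring.axioms(1)[OF D]])
  show "inverse_matrix f \<in> carrier (Mat D)"
    using f by (auto simp: inverse_matrix_def matrix_ring_def V ring_hom_closed)
  have 1: "(\<Oplus>\<^bsub>D\<^esub>k \<in> {..<n}. f (U i k) \<otimes>\<^bsub>D\<^esub> f (V k j)) = (if i = j then \<one>\<^bsub>D\<^esub> else \<zero>\<^bsub>D\<^esub>)"
    if ij: "i < n" "j < n" for i j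
  proof -
    have "f (\<Oplus>\<^bsub>G\<^esub>k \<in> {..<n}. U i k \<otimes>\<^bsub>G\<^esub> V k j) = (\<Oplus>\<^bsub>D\<^esub>k \<in> {..<n}. f (U i k) \<otimes>\<^bsub>D\<^esub> f (V k j))"
      by (rule ring_hom_finsum[OF G_cring D f]) (use ij U V f_simps in simp_all)
    then show ?thesis unfolding UV[OF ij] using f01 by (cases "i = j") simp_all
  qed
  have 2: "(\<Oplus>\<^bsub>D\<^esub>k \<in> {..<n}. f (V i k) \<otimes>\<^bsub>D\<^esub> f (U k j)) = (if i = j then \<one>\<^bsub>D\<^esub> else \<zero>\<^bsub>D\<^esub>)"
    if ij: "i < n" "j < n" for i j
  proof -
    have "f (\<Oplus>\<^bsub>G\<^esub>k \<in> {..<n}. V i k \<otimes>\<^bsub>G\<^esub> U k j) = (\<Oplus>\<^bsub>D\<^esub>k \<in> {..<n}. f (V i k) \<otimes>\<^bsub>D\<^esub> f (U k j))"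
      by (rule ring_hom_finsum[OF G_cring D f]) (use ij U V f_simps in simp_all)
    then show ?thesis unfolding VU[OF ij] using f01 by (cases "i = j") simp_all
  qed
  have "(\<Oplus>\<^bsub>D\<^esub>k \<in> {..<n}. point_matrix f (i, k) \<otimes>\<^bsub>D\<^esub> inverse_matrix f (k, j))
      = (if i = j then \<one>\<^bsub>D\<^esub> else \<zero>\<^bsub>D\<^esub>)" if ij: "i < n" "j < n" for i j
    unfolding 1[OF ij, symmetric] using ij U V
    by (intro D.finsum_cong') (simp_all add: point_matrix_def inverse_matrix_def Pi_iff f_simps)
  then show "point_matrix f \<otimes>\<^bsub>Mat D\<^esub> inverse_matrix f = \<one>\<^bsub>Mat D\<^esub>"
    by (auto simp: matrix_ring_def fun_eq_iff restrict_def)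
  have "(\<Oplus>\<^bsub>D\<^esub>k \<in> {..<n}. inverse_matrix f (i, k) \<otimes>\<^bsub>D\<^esub> point_matrix f (k, j))
      = (if i = j then \<one>\<^bsub>D\<^esub> else \<zero>\<^bsub>D\<^esub>)" if ij: "i < n" "j < n" for i j
    unfolding 2[OF ij, symmetric] using ij U V
    by (intro D.finsum_cong') (simp_all add: point_matrix_def inverse_matrix_def Pi_iff f_simps)
  then show "inverse_matrix f \<otimes>\<^bsub>Mat D\<^esub> point_matrix f = \<one>\<^bsub>Mat D\<^esub>"
    by (auto simp: matrix_ring_def fun_eq_iff restrict_def)
qed

lemma Mat_ring: "cring D \<Longrightarrow> ring (Mat D)"
  by (intro ring.matrix_ring_is_ring cring.axioms(1)) simp_all

lemma point_matrix_unit: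
  "cring D \<Longrightarrow> f \<in> ring_hom G D \<Longrightarrow> point_matrix f \<in> Units (Mat D)"
  using point_matrix_inverse[of D f] point_matrix_closed[of f D] unfolding Units_def by blast

text \<open>
  The formula for the comultiplication of \<open>U i j\<close> is matrix multiplication. The further homomorphism
  \<open>e\<close> is there because the universal points of the group live over \<open>G\<close> and over the tensor square,
  while the matrices are compared over a residue ring.
\<close>

lemma point_matrix_mult:
  assumes C: "cring C" and pf: "point_over C \<sigma> f" and ph: "point_over C \<sigma> h"
    and D: "cring D" and e: "e \<in> ring_hom C D"
  shows "point_matrix (e \<circ> point_mult G C f h)
    = point_matrix (e \<circ> f) \<otimes>\<^bsub>Mat D\<^esub> point_matrix (e \<circ> h)"
proof -
  interpret tensor_target R G G C f h by (rule tensor_target_points[OF C pf ph])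
  have hom: "e \<circ> tensor_lift C f h \<in> ring_hom T D" by (rule ring_hom_trans[OF tensor_lift_hom e])
  interpret D: cring D by (rule D)
  have entry: "e (point_mult G C f h (U i j)) = (\<Oplus>\<^bsub>D\<^esub>k \<in> {..<n}. e (f (U i k)) \<otimes>\<^bsub>D\<^esub> e (h (U k j)))"
    if ij: "i < n" "j < n" for i j
  proof -
    have "e (point_mult G C f h (U i j))
        = (e \<circ> tensor_lift C f h) (\<Oplus>\<^bsub>T\<^esub>k \<in> {..<n}. pure_tensor R G G (U i k) (U k j))"
      using ij by (simp add: point_mult_def comult_U)
    also have "\<dots> = (\<Oplus>\<^bsub>D\<^esub>k \<in> {..<n}. e (f (U i k)) \<otimes>\<^bsub>D\<^esub> e (h (U k j)))"
      by (rule ring_hom_finsum[OF tensor_cring D hom])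
         (use ij U in \<open>simp_all add: pure_tensor_closed tensor_lift_pure ring_hom_mult[OF e] f_simps h_simps\<close>)
    finally show ?thesis .
  qed
  have "(\<Oplus>\<^bsub>D\<^esub>k \<in> {..<n}. point_matrix (e \<circ> f) (i, k) \<otimes>\<^bsub>D\<^esub> point_matrix (e \<circ> h) (k, j))
      = e (point_mult G C f h (U i j))" if ij: "i < n" "j < n" for i j
    unfolding entry[OF ij] using ij U
    by (intro D.finsum_cong') (simp_all add: point_matrix_def Pi_iff ring_hom_closed[OF e] f_simps h_simps)
  then show ?thesis
    by (auto simp: matrix_ring_def fun_eq_iff restrict_def point_matrix_def[of "e \<circ> point_mult G C f h"])
qed

lemma point_matrix_twisted_point:
  assumes C: "cring C" and c: "point_over C \<sigma> (const_point C g)" and \<tau>: "\<tau> \<in> alg_hom R G G"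
    and x: "point_over C \<sigma> x" and y: "point_over C \<sigma> y"
    and D: "cring D" and e: "e \<in> ring_hom C D"
  shows "point_matrix (e \<circ> twisted_point G g \<tau> C x y)
    = point_matrix (e \<circ> const_point C g) \<otimes>\<^bsub>Mat D\<^esub> point_matrix (e \<circ> x \<circ> \<tau> \<circ> antipode G)
      \<otimes>\<^bsub>Mat D\<^esub> point_matrix (e \<circ> y)"
proof -
  have z: "point_over C \<sigma> (x \<circ> \<tau> \<circ> antipode G)"
    by (intro point_over_comp_alg_hom x \<tau> antipode_hom)
  show ?thesis
    unfolding twisted_point_def
    by (simp only: point_matrix_mult[OF C point_over_point_mult[OF C c z] y D e]
        point_matrix_mult[OF C c z D e])
       (simp only: comp_assoc)
qed

text \<open>
  Equal matrices have equal inverses, so the two points agree on the entries of \<open>V\<close> as well as on those of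
  \<open>U\<close>; with the scalars these generate the coordinate ring.
\<close>

lemma point_eqI:
  assumes D: "cring D" and x: "point_over D \<sigma> x" and y: "point_over D \<sigma> y"
    and eq: "point_matrix x = point_matrix y" and a: "a \<in> carrier G"
  shows "x a = y a"
proof -
  interpret M: ring "Mat D" by (rule Mat_ring[OF D])
  note xh = point_over_hom[OF x] and yh = point_over_hom[OF y]
  interpret x: ring_hom_ring G D x by (rule ring_hom_ringI2) (use D G_cring xh cring.axioms(1) in auto)
  interpret y: ring_hom_ring G D y by (rule ring_hom_ringI2) (use D G_cring yh cring.axioms(1) in auto)
  have inv: "inverse_matrix x = inverse_matrix y"
    using M.inv_unique[OF point_matrix_inverse(3)[OF D xh] point_matrix_inverse(2)[OF D yh, folded eq]]
      point_matrix_closed[OF xh] point_matrix_inverse(1)[OF D xh] point_matrix_inverse(1)[OF D yh]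
    by simp
  let ?H = "(\<lambda>r. r \<odot>\<^bsub>G\<^esub> \<one>\<^bsub>G\<^esub>) ` carrier R \<union>
      {U i j | i j. i < n \<and> j < n} \<union> {V i j | i j. i < n \<and> j < n}"
  have H: "x b = y b" if "b \<in> ?H" for b
    using that
  proof (elim UnE)
    assume "b \<in> {U i j | i j. i < n \<and> j < n}"
    then obtain i j where "i < n" "j < n" "b = U i j" by blast
    then show ?thesis using fun_cong[OF eq, of "(i, j)"] by (simp add: point_matrix_def)
  next
    assume "b \<in> {V i j | i j. i < n \<and> j < n}"
    then obtain i j where "i < n" "j < n" "b = V i j" by blast
    then show ?thesis using fun_cong[OF inv, of "(i, j)"] by (simp add: inverse_matrix_def)
  qed (use point_over_scalar[OF x] point_over_scalar[OF y] in auto)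
  have "a \<in> generate_ring G ?H" using a generate by simp
  then show ?thesis
  proof (induction rule: generate_ring.induct)
    case (incl h)
    then show ?case by (rule H)
  next
    case (a_inv h)
    then show ?case using generate by simp
  next
    case (eng_add h1 h2)
    then show ?case using generate by simp
  next
    case (eng_mult h1 h2)
    then show ?case using generate by simp
  qed simp
qed

end

lemma linear_group_exists:
  assumes "affine_group_scheme R G" "linear_group_scheme R G"
  shows "\<exists>n U V. linear_group R G n U V"
  using assms unfolding linear_group_scheme_def
  by (elim exE conjE) (intro exI linear_group.intro group_scheme.intro linear_group_axioms.intro; simp)

section \<open>Lifts of Frobenius\<close>

context linear_group
begin

text \<open>
  The restriction of \<open>F\<close> to the coordinate ring, reduced modulo \<open>p ^ m\<close>. For a lift of Frobenius it
  is a point of \<open>G\<close> over the composite of \<open>\<phi>\<close> with the structure map of the residue ring.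
\<close>

definition residue_point :: "nat \<Rightarrow> nat \<Rightarrow> ((nat \<Rightarrow> 'a set) \<Rightarrow> nat \<Rightarrow> 'a set) \<Rightarrow> 'a \<Rightarrow> 'a set"
  where "residue_point p m F a = F (to_completion p G a) m"

abbreviation "residue_ring p m \<equiv> G Quot pow_ideal p G m"

lemma adic_G: "adic G"
  by (rule adic.intro) (rule G_cring)

lemma residue_ring_cring: "cring (residue_ring p m)"
  by (rule adic.Q_cring[OF adic_G])

lemma point_over_residue_point:
  assumes F: "frobenius_lift p R \<phi> G F"
  shows "point_over (residue_ring p m) (\<lambda>r. to_completion p G (\<phi> r \<odot>\<^bsub>G\<^esub> \<one>\<^bsub>G\<^esub>) m) (residue_point p m F)"
proof -
  interpret adic p G by (rule adic_G)
  have "F \<in> ring_hom Ahat Ahat" using F by (simp add: frobenius_lift_def lifts_frobenius_def)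
  then have "(\<lambda>s. s m) \<circ> (F \<circ> \<iota>) \<in> ring_hom G (Q m)"
    by (intro ring_hom_trans[OF ring_hom_trans[OF to_completion_hom] component_hom])
  moreover have "(\<lambda>s. s m) \<circ> (F \<circ> \<iota>) = residue_point p m F" by (auto simp: residue_point_def)
  ultimately show ?thesis
    using F by (simp add: point_over_def frobenius_lift_def residue_point_def)
qed

text \<open>
  Horizontality evaluated on the coordinate ring. The left-hand side involves \<open>F0\<close> only, so any two
  lifts that are horizontal with respect to \<open>F0\<close> have the same right-hand side.
\<close>

lemma horizontal_matrix:
  assumes g: "g \<in> alg_hom R G (alg_via id R)" and \<tau>: "\<tau> \<in> alg_hom R G G"
    and F: "frobenius_lift p R \<phi> G F" and hor: "H_horizontal p G g \<tau> F F0"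
  shows "point_matrix (\<lambda>a. completion_map p G (H_map G g \<tau>) (F0 (to_completion p G a)) m)
    = point_matrix (residue_point p m F \<circ> const_point G g)
      \<otimes>\<^bsub>Mat (residue_ring p m)\<^esub> point_matrix (residue_point p m F \<circ> \<tau> \<circ> antipode G)
      \<otimes>\<^bsub>Mat (residue_ring p m)\<^esub> point_matrix (residue_point p m F)"
proof -
  interpret adic p G by (rule adic_G)
  note x = point_over_hom[OF point_over_residue_point[OF F, of m]]
  note c = point_over_const_point[OF g]
  have H: "H_map G g \<tau> \<in> ring_hom G G"
    unfolding H_map_def
    by (rule point_over_hom[OF point_over_twisted_point[OF G_cring c \<tau> point_over_id point_over_id]])
  have "completion_map p G (H_map G g \<tau>) (F0 (\<iota> a)) m = (residue_point p m F \<circ> H_map G g \<tau>) a"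
    if a: "a \<in> carrier G" for a
    using hor[unfolded H_horizontal_def, rule_format, OF const_in_completion[OF a]]
      completion_map_const[OF G_cring G_cring H a, of p]
    by (simp add: residue_point_def)
  then have "point_matrix (\<lambda>a. completion_map p G (H_map G g \<tau>) (F0 (\<iota> a)) m)
      = point_matrix (residue_point p m F \<circ> H_map G g \<tau>)"
    by (rule point_matrix_cong)
  also have "\<dots> = point_matrix (residue_point p m F \<circ> const_point G g)
      \<otimes>\<^bsub>Mat (residue_ring p m)\<^esub> point_matrix (residue_point p m F \<circ> id \<circ> \<tau> \<circ> antipode G)
      \<otimes>\<^bsub>Mat (residue_ring p m)\<^esub> point_matrix (residue_point p m F \<circ> id)"
    unfolding H_map_def
    by (rule point_matrix_twisted_point[OF G_cring c \<tau> point_over_id point_over_id residue_ring_cring x])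
  finally show ?thesis by simp
qed

text \<open>
  A pairing of \<open>F\<close> and \<open>F'\<close> sends the universal pair of points to the points of \<open>F\<close> and \<open>F'\<close>, so it sends
  the universal value \<open>g x\<^sup>-\<^sup>\<tau> y\<close> to the value at that pair.
\<close>

lemma pairing_matrix:
  assumes g: "g \<in> alg_hom R G (alg_via id R)" and \<tau>: "\<tau> \<in> alg_hom R G G"
    and W: "is_pairing p R G F F' W"
  shows "point_matrix (\<lambda>a. W (completion_map p T (B_map R G g \<tau>) (to_completion p G a)) m)
    = point_matrix (residue_point p m F \<circ> const_point G g)
      \<otimes>\<^bsub>Mat (residue_ring p m)\<^esub> point_matrix (residue_point p m F \<circ> \<tau> \<circ> antipode G)
      \<otimes>\<^bsub>Mat (residue_ring p m)\<^esub> point_matrix (residue_point p m F')"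
proof -
  interpret adic p G by (rule adic_G)
  interpret T: adic p T by (rule adic.intro) (rule tensor_cring)
  define e where "e = (\<lambda>s. s m) \<circ> (W \<circ> T.\<iota>)"
  have "W \<in> ring_hom T.Ahat Ahat" using W by (simp add: is_pairing_def)
  then have e: "e \<in> ring_hom T (Q m)"
    unfolding e_def by (intro ring_hom_trans[OF ring_hom_trans[OF T.to_completion_hom] component_hom])
  have einl: "e (tensor_inl R G G a) = residue_point p m F a"
    and einr: "e (tensor_inr R G G a) = residue_point p m F' a" if a: "a \<in> carrier G" for a
    using W[unfolded is_pairing_def, THEN conjunct2, rule_format, OF const_in_completion[OF a]]
      completion_map_const[OF G_cring tensor_cring tensor_inl_hom a, of p]
      completion_map_const[OF G_cring tensor_cring tensor_inr_hom a, of p]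
    by (simp_all add: e_def residue_point_def)
  note c = point_over_const_point_tensor[OF g]
  have B: "B_map R G g \<tau> \<in> ring_hom G T"
    unfolding B_map_def
    by (rule point_over_hom[OF point_over_twisted_point[OF tensor_cring c \<tau> point_over_inl point_over_inr]])
  have closed: "\<tau> (antipode G a) \<in> carrier G" "const_point G g a \<in> carrier G" if "a \<in> carrier G" for a
    using that \<tau> antipode_hom point_over_hom[OF point_over_const_point[OF g]]
    by (auto simp: alg_hom_def ring_hom_closed)
  have "point_matrix (\<lambda>a. W (completion_map p T (B_map R G g \<tau>) (\<iota> a)) m)
      = point_matrix (e \<circ> B_map R G g \<tau>)"
    by (rule point_matrix_cong)
      (simp add: e_def completion_map_const[OF G_cring tensor_cring B])
  also have "\<dots> = point_matrix (e \<circ> const_point T g)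
      \<otimes>\<^bsub>Mat (Q m)\<^esub> point_matrix (e \<circ> tensor_inl R G G \<circ> \<tau> \<circ> antipode G)
      \<otimes>\<^bsub>Mat (Q m)\<^esub> point_matrix (e \<circ> tensor_inr R G G)"
    unfolding B_map_def
    by (rule point_matrix_twisted_point[OF tensor_cring c \<tau> point_over_inl point_over_inr residue_ring_cring e])
  also have "point_matrix (e \<circ> const_point T g) = point_matrix (residue_point p m F \<circ> const_point G g)"
    by (rule point_matrix_cong) (simp add: const_point_tensor[OF g] einl closed)
  also have "point_matrix (e \<circ> tensor_inl R G G \<circ> \<tau> \<circ> antipode G)
      = point_matrix (residue_point p m F \<circ> \<tau> \<circ> antipode G)"
    by (rule point_matrix_cong) (simp add: einl closed)
  also have "point_matrix (e \<circ> tensor_inr R G G) = point_matrix (residue_point p m F')"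
    by (rule point_matrix_cong) (simp add: einr)
  finally show ?thesis .
qed

text \<open>
  On the image of \<open>R\<close> every lift of Frobenius is given by \<open>\<phi>\<close>, and the coordinates of \<open>g\<close> lie there.
\<close>

lemma residue_point_const:
  assumes g: "g \<in> alg_hom R G (alg_via id R)"
    and F: "frobenius_lift p R \<phi> G F" and F': "frobenius_lift p R \<phi> G F'"
  shows "point_matrix (residue_point p m F \<circ> const_point G g)
    = point_matrix (residue_point p m F' \<circ> const_point G g)"
proof (rule point_matrix_cong)
  fix a assume "a \<in> carrier G"
  then have "g a \<in> carrier R" using g by (auto simp: alg_hom_def alg_via_def ring_hom_def)
  then show "(residue_point p m F \<circ> const_point G g) a = (residue_point p m F' \<circ> const_point G g) a"
    using point_over_scalar[OF point_over_residue_point[OF F, of m]]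
      point_over_scalar[OF point_over_residue_point[OF F', of m]] by (simp add: const_point_def)
qed

text \<open>
  The lifts agree modulo \<open>p\<close> entry by entry; the quotients by \<open>p\<close> are collected into one matrix \<open>E\<close>.
\<close>

lemma residue_point_matrix_congruent:
  assumes F: "frobenius_lift p R \<phi> G F" and F': "frobenius_lift p R \<phi> G F'"
  shows "\<exists>E\<in>carrier (Mat (residue_ring p m)). point_matrix (residue_point p m F)
    = point_matrix (residue_point p m F') \<oplus>\<^bsub>Mat (residue_ring p m)\<^esub> [p] \<cdot>\<^bsub>Mat (residue_ring p m)\<^esub> E"
proof -
  interpret adic p G by (rule adic_G)
  interpret Q: cring "Q m" by (rule Q_cring)
  interpret M: ring "Mat (Q m)" by (rule Mat_ring[OF Q_cring])
  have "\<exists>y\<in>carrier (Q m). residue_point p m F (U i j) = residue_point p m F' (U i j) \<oplus>\<^bsub>Q m\<^esub> [p] \<cdot>\<^bsub>Q m\<^esub> y"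
    if "i < n" "j < n" for i j
    unfolding residue_point_def
    by (rule lifts_frobenius_congruent[OF completion_cring Q_cring component_hom])
       (use F F' that U const_in_completion in \<open>auto simp: frobenius_lift_def\<close>)
  then obtain y where y: "\<And>i j. i < n \<Longrightarrow> j < n \<Longrightarrow> y i j \<in> carrier (Q m)"
      "\<And>i j. i < n \<Longrightarrow> j < n \<Longrightarrow>
        residue_point p m F (U i j) = residue_point p m F' (U i j) \<oplus>\<^bsub>Q m\<^esub> [p] \<cdot>\<^bsub>Q m\<^esub> (y i j)"
    by metis
  define E where "E = (\<lambda>(i, j) \<in> {..<n} \<times> {..<n}. y i j)"
  have E: "E \<in> carrier (Mat (Q m))" using y(1) by (auto simp: E_def matrix_ring_def)
  have "point_matrix (residue_point p m F) = point_matrix (residue_point p m F') \<oplus>\<^bsub>Mat (Q m)\<^esub> [p] \<cdot>\<^bsub>Mat (Q m)\<^esub> E"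
    (is "?L = ?R")
  proof (rule PiE_ext)
    show "?L \<in> {..<n} \<times> {..<n} \<rightarrow>\<^sub>E carrier (Q m)"
      using point_matrix_closed[OF point_over_hom[OF point_over_residue_point[OF F]], of m]
      by (simp add: matrix_ring_def)
    have "?R \<in> carrier (Mat (Q m))"
      using point_matrix_closed[OF point_over_hom[OF point_over_residue_point[OF F']], of m] E by simp
    then show "?R \<in> {..<n} \<times> {..<n} \<rightarrow>\<^sub>E carrier (Q m)" by (simp add: matrix_ring_def)
    fix ij assume "ij \<in> {..<n} \<times> {..<n}"
    then obtain i j where ij: "ij = (i, j)" "i < n" "j < n" by auto
    have "?R (i, j) = point_matrix (residue_point p m F') (i, j) \<oplus>\<^bsub>Q m\<^esub> ([p] \<cdot>\<^bsub>Mat (Q m)\<^esub> E) (i, j)"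
      using ij by (simp add: matrix_ring_def)
    also have "\<dots> = ?L (i, j)"
      using ij Q.matrix_ring_nat_multiple[OF _ E, of i j p] y(2)[of i j]
      by (simp add: point_matrix_def E_def)
    finally show "?L ij = ?R ij" by (simp add: ij)
  qed
  with E show ?thesis by blast
qed

lemma frobenius_lift_unique:
  assumes p: "odd p" and g: "g \<in> alg_hom R G (alg_via id R)" and \<tau>: "\<tau> \<in> alg_hom R G G"
    and F0: "frobenius_lift p R \<phi> G F0" and F1: "frobenius_lift p R \<phi> G F1"
    and F2: "frobenius_lift p R \<phi> G F2"
    and hor: "H_horizontal p G g \<tau> F1 F0" "H_horizontal p G g \<tau> F2 F0"
    and sym: "B_symmetric p R G g \<tau> F1 F0" "B_symmetric p R G g \<tau> F2 F0"
    and s: "s \<in> carrier (completion p G)"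
  shows "F1 s = F2 s"
proof -
  interpret adic p G by (rule adic_G)
  have "F1 (\<iota> a) m = F2 (\<iota> a) m" if a: "a \<in> carrier G" for a m
  proof -
    interpret Q: cring "Q m" by (rule Q_cring)
    interpret M: ring "Mat (Q m)" by (rule Mat_ring[OF Q_cring])
    define P where "P = point_matrix (residue_point p m F0 \<circ> const_point G g)"
    define Z where "Z F = point_matrix (residue_point p m F \<circ> \<tau> \<circ> antipode G)" for F
    define W where "W F = point_matrix (residue_point p m F)" for F
    have P: "point_matrix (residue_point p m F \<circ> const_point G g) = P" if "frobenius_lift p R \<phi> G F" for F
      unfolding P_def by (rule residue_point_const[OF g that F0])
    note x = point_over_residue_point[of p \<phi> _ m]
    have P_unit: "P \<in> Units (Mat (Q m))"
      unfolding P_def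
      by (intro point_matrix_unit Q_cring ring_hom_trans[OF point_over_hom[OF point_over_const_point[OF g]]]
          point_over_hom[OF x[OF F0]])
    have units: "Z F \<in> Units (Mat (Q m))" "W F \<in> Units (Mat (Q m))" if "frobenius_lift p R \<phi> G F" for F
      unfolding Z_def W_def
      by (rule point_matrix_unit[OF Q_cring point_over_hom[OF
            point_over_comp_alg_hom[OF point_over_comp_alg_hom[OF x[OF that] \<tau>] antipode_hom]]])
         (rule point_matrix_unit[OF Q_cring point_over_hom[OF x[OF that]]])
    have symm: "P \<otimes>\<^bsub>Mat (Q m)\<^esub> Z F0 \<otimes>\<^bsub>Mat (Q m)\<^esub> W F = P \<otimes>\<^bsub>Mat (Q m)\<^esub> Z F \<otimes>\<^bsub>Mat (Q m)\<^esub> W F0"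
      if F: "frobenius_lift p R \<phi> G F" and symF: "B_symmetric p R G g \<tau> F F0" for F
    proof -
      (* A is dual to the pair (F0, F), B to the pair (F, F0). *)
      obtain A B where AB: "is_pairing p R G F0 F A" "is_pairing p R G F F0 B"
        "\<And>s. s \<in> carrier Ahat \<Longrightarrow> A (completion_map p T (B_map R G g \<tau>) s)
          = B (completion_map p T (B_map R G g \<tau>) s)"
        using symF unfolding B_symmetric_def by blast
      have "point_matrix (\<lambda>a. A (completion_map p T (B_map R G g \<tau>) (\<iota> a)) m)
          = point_matrix (\<lambda>a. B (completion_map p T (B_map R G g \<tau>) (\<iota> a)) m)"
        by (rule point_matrix_cong) (simp add: AB(3) const_in_completion)
      then show ?thesis
        unfolding pairing_matrix[OF g \<tau> AB(1)] pairing_matrix[OF g \<tau> AB(2)] P[OF F] P[OF F0]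
        by (simp add: Z_def W_def)
    qed
    have horiz: "P \<otimes>\<^bsub>Mat (Q m)\<^esub> Z F1 \<otimes>\<^bsub>Mat (Q m)\<^esub> W F1 = P \<otimes>\<^bsub>Mat (Q m)\<^esub> Z F2 \<otimes>\<^bsub>Mat (Q m)\<^esub> W F2"
      using horizontal_matrix[OF g \<tau> F1 hor(1), of m] horizontal_matrix[OF g \<tau> F2 hor(2), of m]
      unfolding P[OF F1] P[OF F2] by (simp add: Z_def W_def)
    obtain E1 E2 where E: "E1 \<in> carrier (Mat (Q m))" "W F1 = W F0 \<oplus>\<^bsub>Mat (Q m)\<^esub> [p] \<cdot>\<^bsub>Mat (Q m)\<^esub> E1"
        "E2 \<in> carrier (Mat (Q m))" "W F2 = W F0 \<oplus>\<^bsub>Mat (Q m)\<^esub> [p] \<cdot>\<^bsub>Mat (Q m)\<^esub> E2"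
      using residue_point_matrix_congruent[OF F1 F0, of m] residue_point_matrix_congruent[OF F2 F0, of m]
      unfolding W_def by blast
    have pm: "[(p ^ m)] \<cdot>\<^bsub>Mat (Q m)\<^esub> \<one>\<^bsub>Mat (Q m)\<^esub> = \<zero>\<^bsub>Mat (Q m)\<^esub>"
      by (rule Q.matrix_ring_characteristic[OF finite_lessThan Q_p_power])
    have "W F1 = W F2"
      by (rule M.equal_of_matrix_relations[OF p pm P_unit units(1)[OF F0] units(2)[OF F0] _ _ _ _ E
            symm[OF F1 sym(1)] symm[OF F2 sym(2)] horiz])
         (use units F1 F2 M.Units_closed in auto)
    then have "residue_point p m F1 a = residue_point p m F2 a"
      unfolding W_def by (rule point_eqI[OF Q_cring x[OF F1] x[OF F2] _ a])
    then show ?thesis by (simp add: residue_point_def)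
  qed
  note eq = this
  have hom: "F1 \<in> ring_hom Ahat Ahat" "F2 \<in> ring_hom Ahat Ahat"
    using F1 F2 by (simp_all add: frobenius_lift_def lifts_frobenius_def)
  show ?thesis
    by (rule ring_hom_eq_of_eq_on_constants[OF hom _ s]) (rule ext, rule eq)
qed

end

theorem corollary3p18:
  fixes p :: nat
    and R :: "'r ring"
    and \<phi> :: "'r \<Rightarrow> 'r"
    and G :: "('r, 'a) hopf"
    and g :: "'a \<Rightarrow> 'r"
    and \<tau> :: "'a \<Rightarrow> 'a"
    and \<phi>G0 \<phi>G1 \<phi>G2 :: "(nat \<Rightarrow> 'a set) \<Rightarrow> (nat \<Rightarrow> 'a set)"
  assumes "Factorial_Ring.prime p" and "odd p"
    and "base_ring p R"
    and "lifts_frobenius p R \<phi>"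
    and "affine_group_scheme R G"
    and "smooth_algebra R G"
    and "linear_group_scheme R G"
    and "g \<in> alg_hom R G (alg_via id R)"
    and "involution R G \<tau>"
    and "frobenius_lift p R \<phi> G \<phi>G0"
    and "frobenius_lift p R \<phi> G \<phi>G1"
    and "frobenius_lift p R \<phi> G \<phi>G2"
    and "H_horizontal p G g \<tau> \<phi>G1 \<phi>G0"
    and "H_horizontal p G g \<tau> \<phi>G2 \<phi>G0"
    and "B_symmetric p R G g \<tau> \<phi>G1 \<phi>G0"
    and "B_symmetric p R G g \<tau> \<phi>G2 \<phi>G0"
  shows "\<forall>s \<in> carrier (completion p G). \<phi>G1 s = \<phi>G2 s"
proof
  fix s assume s: "s \<in> carrier (completion p G)"
  obtain n U V where emb: "linear_group R G n U V"
    using linear_group_exists[OF \<open>affine_group_scheme R G\<close> \<open>linear_group_scheme R G\<close>] by blast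
  have "\<tau> \<in> alg_hom R G G" using \<open>involution R G \<tau>\<close> by (simp add: involution_def)
  then show "\<phi>G1 s = \<phi>G2 s"
    using assms s by (intro linear_group.frobenius_lift_unique[OF emb])
qed

end
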